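(* Fix $j_0\in\mathcal{N}\setminus\{1\}$. Suppose that for each $j\in\mathcal{N}\setminus\{1,j_0\}$ the two-marginal problem $\inf\{\int c_{1j}\,d\tau:\tau\in\Pi(\mu_1,\mu_j)\}$ has its optimal plan induced by a unique transport map $T_j:X_1\to X_j$, i.e. the optimal plan is $(\mathrm{id}\times T_j)\#\mu_1$. Let $\lambda$ be an optimal plan of (MKP) and write $\pi_{1j_0}\#\lambda=\mu^{x_1}_{j_0}\otimes\mu_1$ with $\mu_{j_0}^{x_1}\in P(X_{j_0})$. Then $$\lambda=\Big(\prod_{j=2}^{j_0-1}\delta_{T_j(x_1)}\times\mu^{x_1}_{j_0}\times\prod_{j=j_0+1}^N\delta_{T_j(x_1)}\Big)\otimes\mu_1.$$ If in addition the two-marginal problem for $j=j_0$ has a unique solution, then (MKP) has a unique optimal plan.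
   Context: Let $N\ge 3$, $\mathcal{N}=\{1,\ldots,N\}$, $\mu_k$ Borel probability measures on complete separable metric spaces $X_k$; $\Pi(\cdot)$ denotes sets of probability measures with prescribed marginals. The cost $c:\prod_kX_k\to\mathbb{R}$ is lower semicontinuous with $c\ge\sum_ka_k(x_k)$, $a_k\in L_1(\mu_k)$; (MKP) is $\inf\{\int c\,d\lambda:\lambda\in\Pi(\mu_1,\ldots,\mu_N)\}$, assumed attained (minimizers = optimal plans). $(\varphi_1,\ldots,\varphi_N)$ is a fixed solution of the dual problem $\sup\{\sum_k\int\varphi_kd\mu_k:\varphi_k\in L_1(\mu_k),\sum_k\varphi_k(x_k)\le c\}$. For $j\in\mathcal{N}\setminus\{1\}$, $$c_{1j}(x_1,x_j)=\inf_{(x_k)_{k\in\mathcal{N}\setminus\{1,j\}}}\Big\{c(x_1,\ldots,x_N)-\sum_{k\in\mathcal{N}\setminus\{1,j\}}\varphi_k(x_k)\Big\},$$ and $\pi_{1j}:\prod_kX_k\to X_1\times X_j$ is the projection. For a measure $\sigma$ on $A$ and a measurable family $(\eta^a)$ of probability measures on $B$, $(\eta^a\otimes\sigma)(E\times F)=\int_E\eta^a(F)d\sigma(a)$; $\delta_y$ is a Dirac mass; the product of measures in the displayed formula is taken in the coordinate order $X_2,\ldots,X_N$. *)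

theory Defs
  imports "HOL-Probability.Probability"
begin

definition borel_of :: "'a topology \<Rightarrow> 'a measure" where
  "borel_of T = sigma (topspace T) {U. openin T U}"

definition lsc_top :: "'a topology \<Rightarrow> ('a \<Rightarrow> real) \<Rightarrow> bool" where
  "lsc_top T f \<longleftrightarrow> (\<forall>t. openin T {x \<in> topspace T. t < f x})"

definition plans :: "nat \<Rightarrow> (nat \<Rightarrow> 'a measure) \<Rightarrow> (nat \<Rightarrow> 'a) measure set" where
  "plans N \<mu> = {P. sets P = sets (PiM {1..N} \<mu>) \<and>
                    (\<forall>k\<in>{1..N}. distr P (\<mu> k) (\<lambda>x. x k) = \<mu> k)}"

text \<open>Optimal plans of (MKP) (the minimum is finite, since c is bounded below by an
  integrable function and the dual problem has a solution).\<close>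
definition opt_MK :: "nat \<Rightarrow> (nat \<Rightarrow> 'a measure) \<Rightarrow> ((nat \<Rightarrow> 'a) \<Rightarrow> real)
                       \<Rightarrow> (nat \<Rightarrow> 'a) measure \<Rightarrow> bool" where
  "opt_MK N \<mu> c P \<longleftrightarrow> P \<in> plans N \<mu> \<and> integrable P c \<and>
     (\<forall>P'\<in>plans N \<mu>. integrable P' c \<longrightarrow> (\<integral>x. c x \<partial>P) \<le> (\<integral>x. c x \<partial>P'))"

definition dual_adm :: "nat \<Rightarrow> (nat \<Rightarrow> 'a metric) \<Rightarrow> (nat \<Rightarrow> 'a measure)
                         \<Rightarrow> ((nat \<Rightarrow> 'a) \<Rightarrow> real) \<Rightarrow> (nat \<Rightarrow> 'a \<Rightarrow> real) \<Rightarrow> bool" where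
  "dual_adm N X \<mu> c \<psi> \<longleftrightarrow> (\<forall>k\<in>{1..N}. integrable (\<mu> k) (\<psi> k)) \<and>
     (\<forall>x\<in>PiE {1..N} (\<lambda>k. mspace (X k)). (\<Sum>k\<in>{1..N}. \<psi> k (x k)) \<le> c x)"

definition dual_sol :: "nat \<Rightarrow> (nat \<Rightarrow> 'a metric) \<Rightarrow> (nat \<Rightarrow> 'a measure)
                         \<Rightarrow> ((nat \<Rightarrow> 'a) \<Rightarrow> real) \<Rightarrow> (nat \<Rightarrow> 'a \<Rightarrow> real) \<Rightarrow> bool" where
  "dual_sol N X \<mu> c \<phi> \<longleftrightarrow> dual_adm N X \<mu> c \<phi> \<and>
     (\<forall>\<psi>. dual_adm N X \<mu> c \<psi> \<longrightarrow>
        (\<Sum>k\<in>{1..N}. \<integral>x. \<psi> k x \<partial>\<mu> k) \<le> (\<Sum>k\<in>{1..N}. \<integral>x. \<phi> k x \<partial>\<mu> k))"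

definition cost_1j :: "nat \<Rightarrow> (nat \<Rightarrow> 'a metric) \<Rightarrow> ((nat \<Rightarrow> 'a) \<Rightarrow> real)
                        \<Rightarrow> (nat \<Rightarrow> 'a \<Rightarrow> real) \<Rightarrow> nat \<Rightarrow> 'a \<Rightarrow> 'a \<Rightarrow> real" where
  "cost_1j N X c \<phi> j x1 xj =
     Inf {c ((y(1 := x1))(j := xj)) - (\<Sum>k\<in>{1..N} - {1, j}. \<phi> k (y k)) | y.
            y \<in> PiE ({1..N} - {1, j}) (\<lambda>k. mspace (X k))}"

text \<open>Two-marginal plans Pi(mu, nu) and optimal plans for a cost f.  Since the
  reduced cost need not be Borel, integrals are taken w.r.t. the completion.\<close>
definition plans2 :: "'a measure \<Rightarrow> 'b measure \<Rightarrow> ('a \<times> 'b) measure set" where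
  "plans2 \<mu> \<nu> = {\<tau>. sets \<tau> = sets (\<mu> \<Otimes>\<^sub>M \<nu>) \<and> distr \<tau> \<mu> fst = \<mu> \<and> distr \<tau> \<nu> snd = \<nu>}"

definition opt2 :: "'a measure \<Rightarrow> 'b measure \<Rightarrow> ('a \<times> 'b \<Rightarrow> real) \<Rightarrow> ('a \<times> 'b) measure \<Rightarrow> bool" where
  "opt2 \<mu> \<nu> f \<tau> \<longleftrightarrow> \<tau> \<in> plans2 \<mu> \<nu> \<and> integrable (completion \<tau>) f \<and>
     (\<forall>\<tau>'\<in>plans2 \<mu> \<nu>. integrable (completion \<tau>') f \<longrightarrow>
        (\<integral>z. f z \<partial>completion \<tau>) \<le> (\<integral>z. f z \<partial>completion \<tau>'))"

end

theory Submission
  imports Defs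
begin

text \<open>
  If there is no duality gap, then \<open>c = \<Sum>k. \<phi> k (x k)\<close> almost everywhere for an optimal plan \<open>P\<close>,
  whereas the reduced cost always dominates \<open>\<phi> 1 + \<phi> j\<close>.  So the reduced cost equals
  \<open>\<phi> 1 + \<phi> j\<close> almost everywhere for the marginal of \<open>P\<close> on \<open>X 1 \<times> X j\<close>, and this marginal solves the two-marginal problem.
  By uniqueness of that solution \<open>x j = T j (x 1)\<close> almost everywhere for \<open>j \<noteq> j0\<close>, and \<open>P\<close> is
  the image of its marginal on \<open>X 1 \<times> X j0\<close>.

  The duality itself follows from Hahn--Banach: below the superhedging price there is a linear functional
  on bounded functions, that is, a finitely additive plan of cost at most the dual value.  Its marginals are
  tight, which makes it countably additive on boxes; the resulting measure is at most the finitely additive one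
  on open sets, and hence, by lower semicontinuity, its cost does not exceed the dual value.
\<close>

section \<open>Hahn--Banach for spaces of functions\<close>

text \<open>A dual solution is assumed only to be maximal among admissible families, so equality of
  the primal and dual values has to be proved before slackness can be exploited. The cost is
  unbounded on both sides and merely lower semicontinuous, hence lies outside the domain of a
  functional on bounded functions. It therefore enters as a hedging instrument with price
  \<open>D\<close>, and is later reached from below: its superlevel sets are open, and finite sums
  of their indicators are bounded. Its negative part is controlled by the integrable minorants
  \<open>a k\<close>, cut off at -m, with an error that tends to 0. Working with all bounded
  functions, instead of continuous ones, makes the finitely additive plan a set function on every
  subset. A second obstacle is the reduced cost: an infimum over an uncountable set need not be
  Borel. This is why two-marginal costs are integrated against completions, and why the identity on
  the contact set is obtained through compact subsets, whose projections are compact.\<close>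

definition function_subspace :: "('x \<Rightarrow> real) set \<Rightarrow> bool" where
  "function_subspace B \<longleftrightarrow> (\<lambda>x. 0) \<in> B \<and>
     (\<forall>f\<in>B. \<forall>g\<in>B. (\<lambda>x. f x + g x) \<in> B) \<and> (\<forall>f\<in>B. \<forall>r. (\<lambda>x. r * f x) \<in> B)"

definition sublinear_on :: "('x \<Rightarrow> real) set \<Rightarrow> (('x \<Rightarrow> real) \<Rightarrow> real) \<Rightarrow> bool" where
  "sublinear_on B p \<longleftrightarrow>
     (\<forall>f\<in>B. \<forall>g\<in>B. p (\<lambda>x. f x + g x) \<le> p f + p g) \<and>
     (\<forall>f\<in>B. \<forall>r>0. p (\<lambda>x. r * f x) = r * p f)"

lemma function_subspace_add:
  "function_subspace B \<Longrightarrow> f \<in> B \<Longrightarrow> g \<in> B \<Longrightarrow> (\<lambda>x. f x + g x) \<in> B"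
  by (simp add: function_subspace_def)

lemma function_subspace_scale:
  "function_subspace B \<Longrightarrow> f \<in> B \<Longrightarrow> (\<lambda>x. r * f x) \<in> B"
  by (simp add: function_subspace_def)

lemma function_subspace_uminus:
  "function_subspace B \<Longrightarrow> f \<in> B \<Longrightarrow> (\<lambda>x. - f x) \<in> B"
  using function_subspace_scale[of B f "-1"] by simp

lemma sublinear_on_add:
  "sublinear_on B p \<Longrightarrow> f \<in> B \<Longrightarrow> g \<in> B \<Longrightarrow> p (\<lambda>x. f x + g x) \<le> p f + p g"
  by (simp add: sublinear_on_def)

lemma sublinear_on_scale:
  "sublinear_on B p \<Longrightarrow> f \<in> B \<Longrightarrow> r > 0 \<Longrightarrow> p (\<lambda>x. r * f x) = r * p f"
  by (simp add: sublinear_on_def)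

lemma sublinear_on_zero:
  assumes "function_subspace B" "sublinear_on B p"
  shows "p (\<lambda>x. 0) = 0"
proof -
  have "(\<lambda>x. 0) \<in> B" using assms(1) by (simp add: function_subspace_def)
  from sublinear_on_scale[OF assms(2) this, of 2] show ?thesis by simp
qed

lemma sublinear_on_ge_uminus:
  assumes "function_subspace B" "sublinear_on B p" "f \<in> B"
  shows "- p (\<lambda>x. - f x) \<le> p f"
  using sublinear_on_add[OF assms(2,3) function_subspace_uminus[OF assms(1,3)]]
    sublinear_on_zero[OF assms(1,2)] by simp

text \<open>Oddness turns subadditivity for \<open>- f\<close> and \<open>- g\<close> into
  superadditivity for \<open>f\<close> and \<open>g\<close>, and reduces negative scalars to
  positive ones.\<close>

lemma odd_sublinear_imp_linear:
  assumes B: "function_subspace B" and p: "sublinear_on B p"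
    and odd: "\<And>f. f \<in> B \<Longrightarrow> p (\<lambda>x. - f x) \<le> - p f"
  shows "\<And>f g. f \<in> B \<Longrightarrow> g \<in> B \<Longrightarrow> p (\<lambda>x. f x + g x) = p f + p g"
    and "\<And>f r. f \<in> B \<Longrightarrow> p (\<lambda>x. r * f x) = r * p f"
proof -
  have m: "(\<lambda>x. - f x) \<in> B" if "f \<in> B" for f
    by (rule function_subspace_uminus[OF B that])
  have odd': "p (\<lambda>x. - f x) = - p f" if "f \<in> B" for f
    using odd[OF that] sublinear_on_ge_uminus[OF B p that] by linarith
  have le: "p (\<lambda>x. f x + g x) \<le> p f + p g" if "f \<in> B" "g \<in> B" for f g
    by (rule sublinear_on_add[OF p that])
  show "p (\<lambda>x. f x + g x) = p f + p g" if "f \<in> B" "g \<in> B" for f g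
  proof -
    have fg: "(\<lambda>x. f x + g x) \<in> B" by (rule function_subspace_add[OF B that])
    have "p (\<lambda>x. - f x + - g x) \<le> p (\<lambda>x. - f x) + p (\<lambda>x. - g x)"
      by (rule le) (use m that in auto)
    moreover have "p (\<lambda>x. - f x + - g x) = - p (\<lambda>x. f x + g x)"
      using odd'[OF fg] by (simp add: add.commute)
    ultimately show ?thesis using le[OF that] odd' that by simp
  qed
  show "p (\<lambda>x. r * f x) = r * p f" if "f \<in> B" for f r
  proof -
    have pos: "p (\<lambda>x. r * f x) = r * p f" if "r > 0" "f \<in> B" for r f
      by (rule sublinear_on_scale[OF p that(2,1)])
    consider "r > 0" | "r = 0" | "- r > 0" by linarith
    then show ?thesis
    proof cases
      case 3
      have "p (\<lambda>x. r * f x) = p (\<lambda>x. (- r) * (- f x))" by simp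
      also have "\<dots> = (- r) * p (\<lambda>x. - f x)" by (rule pos) (use 3 m that in auto)
      finally show ?thesis using odd'[OF that] by simp
    qed (use pos that sublinear_on_zero[OF B p] in auto)
  qed
qed

text \<open>The classical improvement of \<open>p\<close> in the direction \<open>y\<close>:
  \<open>t = 0\<close> gives a functional below \<open>p\<close>, and \<open>t = 1\<close> at
  \<open>- y\<close> gives at most \<open>- p y\<close>, so a minimal \<open>p\<close> must be odd.
  The bound \<open>- p (\<lambda>x. - f x)\<close>, independent of \<open>t\<close>, keeps the
  infimum finite.\<close>

lemma sublinear_on_directional_inf:
  fixes p :: "('x \<Rightarrow> real) \<Rightarrow> real"
  assumes B: "function_subspace B" and p: "sublinear_on B p" and y: "y \<in> B"
  defines "p' \<equiv> \<lambda>f. INF t\<in>{0..}. p (\<lambda>x. f x + t * y x) - t * p y"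
  shows "sublinear_on B p'" and "\<And>f t. f \<in> B \<Longrightarrow> t \<ge> 0 \<Longrightarrow> p' f \<le> p (\<lambda>x. f x + t * y x) - t * p y"
proof -
  have add: "(\<lambda>x. f x + g x) \<in> B" if "f \<in> B" "g \<in> B" for f g
    by (rule function_subspace_add[OF B that])
  have sc: "(\<lambda>x. r * f x) \<in> B" if "f \<in> B" for f r
    by (rule function_subspace_scale[OF B that])
  have m: "(\<lambda>x. - f x) \<in> B" if "f \<in> B" for f
    using sc[OF that, of "-1"] by simp
  have le: "p (\<lambda>x. f x + g x) \<le> p f + p g" if "f \<in> B" "g \<in> B" for f g
    by (rule sublinear_on_add[OF p that])
  have pos: "p (\<lambda>x. r * f x) = r * p f" if "r \<ge> 0" "f \<in> B" for r f
    using sublinear_on_scale[OF p that(2)] that(1) sublinear_on_zero[OF B p] by (cases "r = 0") auto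
  have lb: "- p (\<lambda>x. - f x) \<le> p (\<lambda>x. f x + t * y x) - t * p y" if f: "f \<in> B" and t: "t \<ge> 0" for f t
  proof -
    have "p (\<lambda>x. (f x + t * y x) + - f x) \<le> p (\<lambda>x. f x + t * y x) + p (\<lambda>x. - f x)"
      by (intro le add f sc y m)
    then show ?thesis using pos[OF t y] by simp
  qed
  have bdd: "bdd_below ((\<lambda>t. p (\<lambda>x. f x + t * y x) - t * p y) ` {0..})" if "f \<in> B" for f
    using lb[OF that] by (intro bdd_belowI[of _ "- p (\<lambda>x. - f x)"]) auto
  show up: "p' f \<le> p (\<lambda>x. f x + t * y x) - t * p y" if "f \<in> B" "t \<ge> 0" for f t
    unfolding p'_def by (rule cINF_lower[OF bdd[OF that(1)]]) (use that in auto)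
  have geI: "u \<le> p' f" if "\<And>t. t \<ge> 0 \<Longrightarrow> u \<le> p (\<lambda>x. f x + t * y x) - t * p y" for u f
    unfolding p'_def by (rule cINF_greatest) (use that in auto)
  have hom_le: "p' (\<lambda>x. r * f x) \<le> r * p' f" if r: "r > 0" and f: "f \<in> B" for r f
  proof -
    have "p' (\<lambda>x. r * f x) / r \<le> p' f"
    proof (rule geI)
      fix t :: real assume t: "t \<ge> 0"
      have "p' (\<lambda>x. r * f x) \<le> p (\<lambda>x. r * f x + (r * t) * y x) - (r * t) * p y"
        using up[OF sc[OF f]] r t by simp
      also have "(\<lambda>x. r * f x + (r * t) * y x) = (\<lambda>x. r * (f x + t * y x))"
        by (simp add: algebra_simps)
      also have "p \<dots> = r * p (\<lambda>x. f x + t * y x)"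
        by (rule pos) (use r in \<open>auto intro!: add f sc y\<close>)
      finally show "p' (\<lambda>x. r * f x) / r \<le> p (\<lambda>x. f x + t * y x) - t * p y"
        using r by (simp add: field_simps)
    qed
    then show ?thesis using r by (simp add: field_simps)
  qed
  show "sublinear_on B p'"
    unfolding sublinear_on_def
  proof (intro conjI ballI allI impI)
    fix f g assume f: "f \<in> B" and g: "g \<in> B"
    have "p' (\<lambda>x. f x + g x) - p' g \<le> p' f"
    proof (rule geI)
      fix s :: real assume s: "s \<ge> 0"
      have "p' (\<lambda>x. f x + g x) - (p (\<lambda>x. f x + s * y x) - s * p y) \<le> p' g"
      proof (rule geI)
        fix t :: real assume t: "t \<ge> 0"
        have "p' (\<lambda>x. f x + g x) \<le> p (\<lambda>x. f x + g x + (s + t) * y x) - (s + t) * p y"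
          by (rule up) (use s t in \<open>auto intro!: add f g\<close>)
        also have "(\<lambda>x. f x + g x + (s + t) * y x) = (\<lambda>x. (f x + s * y x) + (g x + t * y x))"
          by (simp add: algebra_simps)
        also have "p \<dots> \<le> p (\<lambda>x. f x + s * y x) + p (\<lambda>x. g x + t * y x)"
          by (intro le add f g sc y)
        finally show "p' (\<lambda>x. f x + g x) - (p (\<lambda>x. f x + s * y x) - s * p y) \<le>
             p (\<lambda>x. g x + t * y x) - t * p y" by (simp add: algebra_simps)
      qed
      then show "p' (\<lambda>x. f x + g x) - p' g \<le> p (\<lambda>x. f x + s * y x) - s * p y" by linarith
    qed
    then show "p' (\<lambda>x. f x + g x) \<le> p' f + p' g" by linarith
  next
    fix f and r :: real assume f: "f \<in> B" and r: "r > 0"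
    have "p' (\<lambda>x. inverse r * (r * f x)) \<le> inverse r * p' (\<lambda>x. r * f x)"
      by (rule hom_le) (use r in \<open>auto intro!: sc f\<close>)
    then have "r * p' f \<le> p' (\<lambda>x. r * f x)" using r by (simp add: field_simps)
    with hom_le[OF r f] show "p' (\<lambda>x. r * f x) = r * p' f" by linarith
  qed
qed

text \<open>Pointwise infima of sublinear functionals need not be subadditive; along a chain they
  are, as two members can be replaced by the smaller one. The common upper bound \<open>q\<close>
  also bounds the infimum from below, by \<open>- q (\<lambda>x. - f x)\<close>.\<close>

lemma sublinear_on_chain_inf:
  fixes C :: "(('x \<Rightarrow> real) \<Rightarrow> real) set"
  assumes B: "function_subspace B" and C: "C \<noteq> {}"
    and sub: "\<And>p. p \<in> C \<Longrightarrow> sublinear_on B p"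
    and ub: "\<And>p f. p \<in> C \<Longrightarrow> f \<in> B \<Longrightarrow> p f \<le> q f"
    and chain: "\<And>p p'. p \<in> C \<Longrightarrow> p' \<in> C \<Longrightarrow> (\<forall>f\<in>B. p f \<le> p' f) \<or> (\<forall>f\<in>B. p' f \<le> p f)"
  shows "sublinear_on B (\<lambda>f. INF p\<in>C. p f)" and "\<And>p f. p \<in> C \<Longrightarrow> f \<in> B \<Longrightarrow> (INF p\<in>C. p f) \<le> p f"
proof -
  define u where "u f = (INF p\<in>C. p f)" for f :: "'x \<Rightarrow> real"
  have add: "(\<lambda>x. f x + g x) \<in> B" if "f \<in> B" "g \<in> B" for f g
    by (rule function_subspace_add[OF B that])
  have sc: "(\<lambda>x. r * f x) \<in> B" if "f \<in> B" for f r
    by (rule function_subspace_scale[OF B that])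
  have m: "(\<lambda>x. - f x) \<in> B" if "f \<in> B" for f
    using sc[OF that, of "-1"] by simp
  have lb: "- q (\<lambda>x. - f x) \<le> p f" if "p \<in> C" "f \<in> B" for p f
    using sublinear_on_ge_uminus[OF B sub[OF that(1)] that(2)] ub[OF that(1) m[OF that(2)]] by linarith
  have bdd: "bdd_below ((\<lambda>p. p f) ` C)" if "f \<in> B" for f
    using lb[OF _ that] by (intro bdd_belowI[of _ "- q (\<lambda>x. - f x)"]) auto
  have up: "u f \<le> p f" if "p \<in> C" "f \<in> B" for p f
    unfolding u_def by (rule cINF_lower[OF bdd[OF that(2)] that(1)])
  then show "(INF p\<in>C. p f) \<le> p f" if "p \<in> C" "f \<in> B" for p f
    using that by (simp add: u_def)
  have geI: "v \<le> u f" if "\<And>p. p \<in> C \<Longrightarrow> v \<le> p f" for v f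
    unfolding u_def by (rule cINF_greatest) (use that C in auto)
  have hom_le: "u (\<lambda>x. r * f x) \<le> r * u f" if r: "r > 0" and f: "f \<in> B" for r f
  proof -
    have "u (\<lambda>x. r * f x) / r \<le> u f"
    proof (rule geI)
      fix p assume p: "p \<in> C"
      have "u (\<lambda>x. r * f x) \<le> r * p f"
        using up[OF p sc[OF f], of r] sublinear_on_scale[OF sub[OF p] f r] by simp
      then show "u (\<lambda>x. r * f x) / r \<le> p f" using r by (simp add: field_simps)
    qed
    then show ?thesis using r by (simp add: field_simps)
  qed
  have "sublinear_on B u"
    unfolding sublinear_on_def
  proof (intro conjI ballI allI impI)
    fix f g assume f: "f \<in> B" and g: "g \<in> B"
    have "u (\<lambda>x. f x + g x) - u g \<le> u f"
    proof (rule geI)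
      fix p assume p: "p \<in> C"
      have "u (\<lambda>x. f x + g x) - p f \<le> u g"
      proof (rule geI)
        fix p' assume p': "p' \<in> C"
        obtain p'' where p'': "p'' \<in> C" "p'' f \<le> p f" "p'' g \<le> p' g"
          using chain[OF p p'] p p' f g by blast
        have "u (\<lambda>x. f x + g x) \<le> p'' (\<lambda>x. f x + g x)" by (rule up[OF p''(1) add[OF f g]])
        also have "\<dots> \<le> p'' f + p'' g" by (rule sublinear_on_add[OF sub[OF p''(1)] f g])
        finally show "u (\<lambda>x. f x + g x) - p f \<le> p' g" using p'' by linarith
      qed
      then show "u (\<lambda>x. f x + g x) - u g \<le> p f" by linarith
    qed
    then show "u (\<lambda>x. f x + g x) \<le> u f + u g" by linarith
  next
    fix f and r :: real assume f: "f \<in> B" and r: "r > 0"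
    have "u (\<lambda>x. inverse r * (r * f x)) \<le> inverse r * u (\<lambda>x. r * f x)"
      by (rule hom_le) (use r in \<open>auto intro!: sc f\<close>)
    then have "r * u f \<le> u (\<lambda>x. r * f x)" using r by (simp add: field_simps)
    with hom_le[OF r f] show "u (\<lambda>x. r * f x) = r * u f" by linarith
  qed
  then show "sublinear_on B (\<lambda>f. INF p\<in>C. p f)" by (simp add: u_def[abs_def])
qed

text \<open>Hahn--Banach: a minimal sublinear functional below \<open>q\<close> is already linear.\<close>
theorem sublinear_dominates_linear:
  fixes q :: "('x \<Rightarrow> real) \<Rightarrow> real"
  assumes B: "function_subspace B" and q: "sublinear_on B q"
  obtains L where "\<And>f g. f \<in> B \<Longrightarrow> g \<in> B \<Longrightarrow> L (\<lambda>x. f x + g x) = L f + L g"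
    and "\<And>f r. f \<in> B \<Longrightarrow> L (\<lambda>x. r * f x) = r * L f" and "\<And>f. f \<in> B \<Longrightarrow> L f \<le> q f"
proof -
  \<comment> \<open>Sublinearity constrains values on \<open>B\<close> only. Setting functionals to
    0 off \<open>B\<close> makes minimality yield an equality of total functions.\<close>
  define cut where "cut p = (\<lambda>f. if f \<in> B then p f else 0)" for p :: "('x \<Rightarrow> real) \<Rightarrow> real"
  define S where "S = {p. sublinear_on B p \<and> (\<forall>f\<in>B. p f \<le> q f) \<and> (\<forall>f. f \<notin> B \<longrightarrow> p f = 0)}"
  have B_add: "(\<lambda>x. f x + g x) \<in> B" if "f \<in> B" "g \<in> B" for f g
    by (rule function_subspace_add[OF B that])
  have B_sc: "(\<lambda>x. r * f x) \<in> B" if "f \<in> B" for f r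
    by (rule function_subspace_scale[OF B that])
  have cut: "cut p \<in> S" if "sublinear_on B p" "\<And>f. f \<in> B \<Longrightarrow> p f \<le> q f" for p
    using that B_add B_sc by (auto simp: S_def cut_def sublinear_on_def)
  \<comment> \<open>Zorn's lemma produces maximal elements, hence the reversed order.\<close>
  let ?le = "\<lambda>p p' :: ('x \<Rightarrow> real) \<Rightarrow> real. p' \<le> p"
  have "\<exists>p\<in>S. \<forall>p'\<in>S. ?le p p' \<longrightarrow> p' = p"
  proof (rule predicate_Zorn)
    show "partial_order_on S (relation_of ?le S)"
      by (rule partial_order_on_relation_ofI) auto
    fix C assume C: "C \<in> Chains (relation_of ?le S)"
    then have CS: "C \<subseteq> S" by (auto simp: Chains_def relation_of_def)
    have ch: "p \<le> p' \<or> p' \<le> p" if "p \<in> C" "p' \<in> C" for p p'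
      using C that by (auto simp: Chains_def relation_of_def)
    show "\<exists>u\<in>S. \<forall>p\<in>C. u \<le> p"
    proof (cases "C = {}")
      case True
      then show ?thesis using cut[OF q] by auto
    next
      case False
      define u where "u = (\<lambda>f. INF p\<in>C. p f)"
      note * = sublinear_on_chain_inf[OF B False, of q]
      have u: "sublinear_on B u" and le: "\<And>p f. p \<in> C \<Longrightarrow> f \<in> B \<Longrightarrow> u f \<le> p f"
        unfolding u_def by (rule *; use CS ch in \<open>force simp: S_def subset_iff le_fun_def\<close>)+
      have "cut u \<in> S"
      proof (rule cut[OF u])
        fix f assume f: "f \<in> B"
        obtain p where p: "p \<in> C" using False by blast
        have "u f \<le> p f" by (rule le[OF p f])
        also have "\<dots> \<le> q f" using p CS f by (auto simp: S_def)
        finally show "u f \<le> q f" .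
      qed
      moreover have "cut u \<le> p" if "p \<in> C" for p
        using le[OF that] that CS by (auto simp: le_fun_def cut_def S_def)
      ultimately show ?thesis by blast
    qed
  qed
  then obtain p where pS: "p \<in> S" and min: "\<And>p'. p' \<in> S \<Longrightarrow> p' \<le> p \<Longrightarrow> p' = p" by blast
  have p: "sublinear_on B p" and pq: "\<And>f. f \<in> B \<Longrightarrow> p f \<le> q f" and p0: "\<And>f. f \<notin> B \<Longrightarrow> p f = 0"
    using pS by (auto simp: S_def)
  have odd: "p (\<lambda>x. - y x) \<le> - p y" if y: "y \<in> B" for y
  proof -
    define p' where "p' = (\<lambda>f. INF t\<in>{0..}. p (\<lambda>x. f x + t * y x) - t * p y)"
    have p': "sublinear_on B p'"
      and up: "\<And>f t. f \<in> B \<Longrightarrow> t \<ge> 0 \<Longrightarrow> p' f \<le> p (\<lambda>x. f x + t * y x) - t * p y"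
      unfolding p'_def using sublinear_on_directional_inf[OF B p y] by auto
    have le: "p' f \<le> p f" if "f \<in> B" for f using up[OF that, of 0] by simp
    have "cut p' = p"
    proof (rule min)
      show "cut p' \<in> S" by (rule cut[OF p']) (use le pq in force)
      show "cut p' \<le> p" using le p0 by (auto simp: le_fun_def cut_def)
    qed
    moreover have m: "(\<lambda>x. - y x) \<in> B" using B_sc[OF y, of "-1"] by simp
    ultimately have "p (\<lambda>x. - y x) = p' (\<lambda>x. - y x)" by (metis cut_def)
    also have "\<dots> \<le> p (\<lambda>x. - y x + 1 * y x) - 1 * p y" by (rule up[OF m]) simp
    also have "\<dots> = - p y" using sublinear_on_zero[OF B p] by simp
    finally show ?thesis .
  qed
  show thesis
    by (rule that[of p]) (use odd_sublinear_imp_linear[OF B p odd] pq in auto)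
qed

section \<open>Tight contents\<close>

text \<open>Sets squeezed between a closed and an open set with small content in the gap, an
  analogue of Jordan measurable sets. Complementation swaps the two approximations and keeps the gap
  \<open>U - C\<close>, which is what makes the class an algebra.\<close>

definition content_regular :: "'x topology \<Rightarrow> ('x set \<Rightarrow> real) \<Rightarrow> 'x set set" where
  "content_regular T l = {E. E \<subseteq> topspace T \<and>
     (\<forall>e>0. \<exists>C U. closedin T C \<and> openin T U \<and> C \<subseteq> E \<and> E \<subseteq> U \<and> l (U - C) \<le> e)}"

lemma content_regularE:
  assumes "E \<in> content_regular T l" "e > 0"
  obtains C U where "closedin T C" "openin T U" "C \<subseteq> E" "E \<subseteq> U" "l (U - C) \<le> e"
  using assms unfolding content_regular_def by blast

text \<open>Modelled on the values of a linear functional on indicators, hence defined on all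
  subsets; countable additivity is what has to be gained from tightness.\<close>

locale finite_content =
  fixes T :: "'x topology" and l :: "'x set \<Rightarrow> real"
  assumes nonneg: "E \<subseteq> topspace T \<Longrightarrow> 0 \<le> l E"
    and additive: "E \<subseteq> topspace T \<Longrightarrow> F \<subseteq> topspace T \<Longrightarrow> E \<inter> F = {} \<Longrightarrow> l (E \<union> F) = l E + l F"
begin

lemma content_empty: "l {} = 0"
  using additive[of "{}" "{}"] by simp

lemma mono: "E \<subseteq> F \<Longrightarrow> F \<subseteq> topspace T \<Longrightarrow> l E \<le> l F"
  using additive[of E "F - E"] nonneg[of "F - E"] by (auto simp: Un_absorb1 subset_iff)

lemma subadditive:
  assumes "E \<subseteq> topspace T" "F \<subseteq> topspace T"
  shows "l (E \<union> F) \<le> l E + l F"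
proof -
  have "l (E \<union> (F - E)) = l E + l (F - E)" by (rule additive) (use assms in auto)
  moreover have "l (F - E) \<le> l F" by (rule mono) (use assms in auto)
  ultimately show ?thesis by simp
qed

lemma subadditive_UN:
  assumes "finite I" "\<And>i. i \<in> I \<Longrightarrow> E i \<subseteq> topspace T"
  shows "l (\<Union>i\<in>I. E i) \<le> (\<Sum>i\<in>I. l (E i))"
  using assms
proof (induction I rule: finite_induct)
  case empty
  then show ?case by (simp add: content_empty)
next
  case (insert i I)
  have "l (E i \<union> (\<Union>i\<in>I. E i)) \<le> l (E i) + l (\<Union>i\<in>I. E i)"
    by (rule subadditive) (use insert in auto)
  then show ?case using insert by simp
qed

lemma algebra_content_regular: "algebra (topspace T) (content_regular T l)"
  unfolding algebra_iff_Un
proof (intro conjI ballI)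
  show "content_regular T l \<subseteq> Pow (topspace T)" by (auto simp: content_regular_def)
  show "{} \<in> content_regular T l" unfolding content_regular_def
    using content_empty by (auto intro!: exI[of _ "{}"])
next
  fix E assume E: "E \<in> content_regular T l"
  then have sub: "E \<subseteq> topspace T" by (auto simp: content_regular_def)
  show "topspace T - E \<in> content_regular T l"
    unfolding content_regular_def
  proof (intro CollectI conjI allI impI)
    fix e :: real assume "e > 0"
    then obtain C U where CU: "closedin T C" "openin T U" "C \<subseteq> E" "E \<subseteq> U" "l (U - C) \<le> e"
      using content_regularE[OF E] by metis
    have "(topspace T - C) - (topspace T - U) = U - C" using openin_subset[OF CU(2)] by auto
    then show "\<exists>C U. closedin T C \<and> openin T U \<and> C \<subseteq> topspace T - E \<and> topspace T - E \<subseteq> U \<and> l (U - C) \<le> e"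
      using CU by (intro exI[of _ "topspace T - U"] exI[of _ "topspace T - C"]) auto
  qed simp
next
  fix E F assume E: "E \<in> content_regular T l" and F: "F \<in> content_regular T l"
  show "E \<union> F \<in> content_regular T l"
    unfolding content_regular_def
  proof (intro CollectI conjI allI impI)
    show "E \<union> F \<subseteq> topspace T" using E F by (auto simp: content_regular_def)
    fix e :: real assume e: "e > 0"
    obtain C U where CU: "closedin T C" "openin T U" "C \<subseteq> E" "E \<subseteq> U" "l (U - C) \<le> e/2"
      using content_regularE[OF E, of "e/2"] e by auto
    obtain C' U' where CU': "closedin T C'" "openin T U'" "C' \<subseteq> F" "F \<subseteq> U'" "l (U' - C') \<le> e/2"
      using content_regularE[OF F, of "e/2"] e by auto
    note sub = openin_subset[OF CU(2)] openin_subset[OF CU'(2)]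
    have "l ((U \<union> U') - (C \<union> C')) \<le> l ((U - C) \<union> (U' - C'))"
      by (rule mono) (use sub in auto)
    also have "\<dots> \<le> l (U - C) + l (U' - C')" by (rule subadditive) (use sub in auto)
    finally show "\<exists>C U. closedin T C \<and> openin T U \<and> C \<subseteq> E \<union> F \<and> E \<union> F \<subseteq> U \<and> l (U - C) \<le> e"
      using CU CU' by (intro exI[of _ "C \<union> C'"] exI[of _ "U \<union> U'"]) auto
  qed
qed

text \<open>Closed inner approximations of a decreasing sequence with empty intersection, cut down to a
  compact set of almost full content, already have an empty finite intersection.\<close>

theorem tight_content_extends:
  assumes tight: "\<And>e. e > 0 \<Longrightarrow> \<exists>K. compactin T K \<and> l (topspace T - K) \<le> e"
  obtains P where "space P = topspace T" "sets P = sigma_sets (topspace T) (content_regular T l)"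
    "\<And>E. E \<in> content_regular T l \<Longrightarrow> emeasure P E = ennreal (l E)"
proof -
  let ?A = "content_regular T l"
  interpret A: algebra "topspace T" ?A by (rule algebra_content_regular)
  have sub: "E \<subseteq> topspace T" if "E \<in> ?A" for E using that by (auto simp: content_regular_def)
  have "\<exists>\<mu> :: 'x set \<Rightarrow> ennreal. (\<forall>s \<in> ?A. \<mu> s = ennreal (l s)) \<and>
      measure_space (topspace T) (sigma_sets (topspace T) ?A) \<mu>"
  proof (rule A.caratheodory_empty_continuous)
    show "positive ?A (\<lambda>E. ennreal (l E))" by (simp add: positive_def content_empty)
    show "Measure_Space.additive ?A (\<lambda>E. ennreal (l E))"
      by (auto simp: Measure_Space.additive_def additive[OF sub sub] ennreal_plus nonneg sub)
    fix A :: "nat \<Rightarrow> 'x set"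
    assume rA: "range A \<subseteq> ?A" and dec: "decseq A" and INT: "(\<Inter>i. A i) = {}"
    have As: "A i \<subseteq> topspace T" for i using rA sub by auto
    have "(\<lambda>i. l (A i)) \<longlonglongrightarrow> 0"
    proof (rule LIMSEQ_I)
      fix e :: real assume e: "e > 0"
      obtain K where K: "compactin T K" "l (topspace T - K) \<le> e/4" using tight[of "e/4"] e by auto
      \<comment> \<open>The weights (e/4)(1/2)^i sum to e/2; with e/4 for the complement of
        \<open>K\<close> the total is at most 3e/4, strictly below e.\<close>
      have "\<exists>C. closedin T C \<and> C \<subseteq> A i \<and> l (A i - C) \<le> (e/4) * (1/2)^i" for i
      proof -
        have "A i \<in> ?A" "(e/4) * (1/2)^i > 0" using rA e by auto
        then obtain C U where CU: "closedin T C" "openin T U" "C \<subseteq> A i" "A i \<subseteq> U" "l (U - C) \<le> (e/4) * (1/2)^i"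
          by (rule content_regularE)
        moreover have "l (A i - C) \<le> l (U - C)" by (rule mono) (use CU openin_subset[OF CU(2)] in auto)
        ultimately show ?thesis by force
      qed
      then obtain C where C: "\<And>i. closedin T (C i)" "\<And>i. C i \<subseteq> A i" "\<And>i. l (A i - C i) \<le> (e/4) * (1/2)^i"
        by metis
      have "K \<inter> \<Inter>(range C) = {}" using INT C(2) by blast
      then obtain \<F> where F: "finite \<F>" "\<F> \<subseteq> range C" "K \<inter> \<Inter>\<F> = {}"
        using K(1) C(1) unfolding compactin_fip by (metis (no_types, lifting) rangeE)
      then obtain J where J: "finite J" "\<F> = C ` J" by (meson finite_subset_image)
      \<comment> \<open>For \<open>m\<close> beyond \<open>n\<close>, \<open>A m\<close> lies in
        every \<open>A j\<close> with \<open>j\<close> in \<open>J\<close>; \<open>insert 0\<close>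
        covers an empty \<open>J\<close>.\<close>
      define n where "n = Max (insert 0 J)"
      have Jn: "j \<le> n" if "j \<in> J" for j using that J(1) by (simp add: n_def)
      have "l (A m) < e" if m: "m \<ge> n" for m
      proof -
        have "A m \<subseteq> (topspace T - K) \<union> (\<Union>j\<in>J. A j - C j)"
        proof
          fix x assume x: "x \<in> A m"
          show "x \<in> (topspace T - K) \<union> (\<Union>j\<in>J. A j - C j)"
          proof (cases "x \<in> K")
            case True
            then obtain j where j: "j \<in> J" "x \<notin> C j" using F(3) J(2) by auto
            have "A m \<subseteq> A j" using dec Jn[OF j(1)] m by (simp add: decseq_def)
            then show ?thesis using j x by auto
          qed (use x As in auto)
        qed
        then have "l (A m) \<le> l ((topspace T - K) \<union> (\<Union>j\<in>J. A j - C j))"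
          by (rule mono) (use As in auto)
        also have "\<dots> \<le> l (topspace T - K) + l (\<Union>j\<in>J. A j - C j)"
          by (rule subadditive) (use As in auto)
        also have "l (\<Union>j\<in>J. A j - C j) \<le> (\<Sum>j\<in>J. l (A j - C j))"
          by (rule subadditive_UN) (use As J in auto)
        also have "\<dots> \<le> (\<Sum>j\<in>J. (e/4) * (1/2)^j)" by (rule sum_mono) (rule C(3))
        also have "\<dots> = (e/4) * (\<Sum>j\<in>J. (1/2)^j)" by (simp add: sum_distrib_left)
        also have "(\<Sum>j\<in>J. (1/2)^j) \<le> (\<Sum>j. (1/2::real)^j)"
          by (rule sum_le_suminf) (use J in auto)
        also have "(\<Sum>j. (1/2::real)^j) = 2" by (simp add: suminf_geometric)
        finally show ?thesis using K(2) e by simp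
      qed
      then show "\<exists>no. \<forall>n\<ge>no. norm (l (A n) - 0) < e" using nonneg[OF As] by auto
    qed
    then show "(\<lambda>i. ennreal (l (A i))) \<longlonglongrightarrow> 0" using tendsto_ennrealI by fastforce
  qed simp
  then obtain \<nu> :: "'x set \<Rightarrow> ennreal" where \<nu>: "\<And>s. s \<in> ?A \<Longrightarrow> \<nu> s = ennreal (l s)"
    "measure_space (topspace T) (sigma_sets (topspace T) ?A) \<nu>" by blast
  have sp: "?A \<subseteq> Pow (topspace T)" using sub by auto
  show thesis
  proof (rule that)
    let ?P = "measure_of (topspace T) ?A \<nu>"
    show "space ?P = topspace T" by (rule space_measure_of[OF sp])
    show "sets ?P = sigma_sets (topspace T) ?A" by (rule sets_measure_of[OF sp])
    show "emeasure ?P E = ennreal (l E)" if "E \<in> ?A" for E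
    proof -
      have "positive (sets ?P) \<nu>" "countably_additive (sets ?P) \<nu>"
        using \<nu>(2) sp by (auto simp: measure_space_def)
      then have "emeasure ?P E = \<nu> E"
        by (intro emeasure_measure_of[of ?P "topspace T" ?A \<nu>]) (use sp that in auto)
      then show ?thesis using \<nu>(1)[OF that] by simp
    qed
  qed
qed

end

section \<open>Borel sets of product and Polish topologies\<close>

lemma space_borel_of [simp]: "space (borel_of T) = topspace T"
  by (simp add: borel_of_def space_measure_of_conv)

lemma sets_borel_of: "sets (borel_of T) = sigma_sets (topspace T) {U. openin T U}"
  unfolding borel_of_def by (rule sets_measure_of) (auto dest: openin_subset)

lemma borel_of_open: "openin T U \<Longrightarrow> U \<in> sets (borel_of T)"
  by (auto simp: sets_borel_of)

lemma borel_of_closed: "closedin T C \<Longrightarrow> C \<in> sets (borel_of T)"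
  using sets.compl_sets[OF borel_of_open[of T "topspace T - C"]] closedin_subset[of T C]
  by (auto simp: closedin_def double_diff)

lemma second_countable_mtopology_of:
  assumes "separable_space (mtopology_of m)"
  shows "second_countable (mtopology_of m)"
proof -
  interpret Metric_space "mspace m" "mdist m" by simp
  have T: "mtopology_of m = mtopology" by (simp add: mtopology_of_def)
  obtain C where C: "countable C" "C \<subseteq> mspace m" "mtopology closure_of C = mspace m"
    using assms unfolding separable_space_def T by auto
  define \<B> where "\<B> = (\<lambda>(q, n). mball q (1 / real (Suc n))) ` (C \<times> UNIV)"
  show ?thesis
    unfolding second_countable_def T
  proof (intro exI[of _ \<B>] conjI allI impI ballI)
    show "countable \<B>" using C(1) by (auto simp: \<B>_def)
    show "openin mtopology V" if "V \<in> \<B>" for V using that by (auto simp: \<B>_def)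
    fix U x assume U: "openin mtopology U \<and> x \<in> U"
    then obtain r where r: "r > 0" "mball x r \<subseteq> U" and x: "x \<in> mspace m"
      by (meson openin_mtopology subsetD)
    obtain n where n: "1 / real (Suc n) < r / 2" using r by (meson half_gt_zero nat_approx_posE)
    have "\<forall>r>0. \<exists>y\<in>C. y \<in> mball x r" using C(3) x unfolding metric_closure_of by auto
    moreover have "1 / real (Suc n) > 0" by simp
    ultimately obtain q where q: "q \<in> C" "q \<in> mball x (1 / real (Suc n))" by blast
    show "\<exists>V\<in>\<B>. x \<in> V \<and> V \<subseteq> U"
    proof (intro bexI[of _ "mball q (1 / real (Suc n))"] conjI)
      show "x \<in> mball q (1 / real (Suc n))" using q by (simp add: commute)
      show "mball q (1 / real (Suc n)) \<subseteq> U"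
      proof
        fix z assume z: "z \<in> mball q (1 / real (Suc n))"
        have "mdist m x z \<le> mdist m x q + mdist m q z" using z q x by (intro triangle) auto
        also have "\<dots> < r" using z q n by auto
        finally show "z \<in> U" using r(2) z x by auto
      qed
    qed (use q in \<open>auto simp: \<B>_def\<close>)
  qed
qed

text \<open>A countable base of boxes makes open sets measurable for the product sigma-algebra, and
  lets their measure be reached along finite unions of boxes, the sets on which the content is under
  control.\<close>

lemma product_topology_countable_boxes:
  assumes I: "finite I" and sc: "\<forall>i\<in>I. second_countable (X i)"
  shows "\<exists>\<B>. countable \<B> \<and> (\<forall>V\<in>\<B>. \<exists>U. (\<forall>i\<in>I. openin (X i) (U i)) \<and> V = PiE I U) \<and>
    (\<forall>W. openin (product_topology X I) W \<longrightarrow> (\<exists>\<U>\<subseteq>\<B>. W = \<Union>\<U>))"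
proof -
  have "\<forall>i\<in>I. \<exists>B. countable B \<and> (\<forall>V\<in>B. openin (X i) V) \<and>
      (\<forall>U x. openin (X i) U \<and> x \<in> U \<longrightarrow> (\<exists>V\<in>B. x \<in> V \<and> V \<subseteq> U))"
    using sc unfolding second_countable_def by blast
  from bchoice[OF this] obtain b where "\<forall>i\<in>I. countable (b i) \<and> (\<forall>V\<in>b i. openin (X i) V) \<and>
      (\<forall>U x. openin (X i) U \<and> x \<in> U \<longrightarrow> (\<exists>V\<in>b i. x \<in> V \<and> V \<subseteq> U))" ..
  then have b: "\<And>i. i \<in> I \<Longrightarrow> countable (b i)" "\<And>i V. i \<in> I \<Longrightarrow> V \<in> b i \<Longrightarrow> openin (X i) V"
    "\<And>i U x. i \<in> I \<Longrightarrow> openin (X i) U \<Longrightarrow> x \<in> U \<Longrightarrow> \<exists>V \<in> b i. x \<in> V \<and> V \<subseteq> U"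
    by auto
  let ?B = "PiE I ` (PiE I b)"
  show ?thesis
  proof (rule exI[of _ ?B], intro conjI ballI allI impI)
    show "countable ?B" using I b(1) by (intro countable_image countable_PiE) auto
    show "\<exists>U. (\<forall>i\<in>I. openin (X i) (U i)) \<and> V = PiE I U" if V: "V \<in> ?B" for V
    proof -
      obtain U where U: "U \<in> PiE I b" and VU: "V = PiE I U" using V by (rule imageE)
      have "openin (X i) (U i)" if "i \<in> I" for i by (rule b(2)[OF that PiE_mem[OF U that]])
      with VU show ?thesis by (intro exI[of _ U]) simp
    qed
    fix W assume W: "openin (product_topology X I) W"
    have *: "\<exists>V\<in>?B. x \<in> V \<and> V \<subseteq> W" if x: "x \<in> W" for x
    proof -
      obtain U where U: "\<forall>i \<in> I. openin (X i) (U i)" "x \<in> PiE I U" "PiE I U \<subseteq> W"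
        using W x unfolding openin_product_topology_alt by blast
      have "\<forall>i\<in>I. \<exists>V. V \<in> b i \<and> x i \<in> V \<and> V \<subseteq> U i"
        using b(3) U(1) PiE_mem[OF U(2)] by blast
      from bchoice[OF this] obtain V where V: "\<forall>i\<in>I. V i \<in> b i \<and> x i \<in> V i \<and> V i \<subseteq> U i" ..
      \<comment> \<open>\<open>PiE I b\<close> contains extensional functions only, so the choice
        function is restricted to \<open>I\<close>; the box does not change.\<close>
      have "PiE I V = PiE I (restrict V I)" by (rule PiE_cong) simp
      moreover have "restrict V I \<in> PiE I b" using V by simp
      ultimately have "PiE I V \<in> ?B" by (rule image_eqI)
      moreover have "x \<in> PiE I V" using V U(2) by (simp add: PiE_iff)
      moreover have "PiE I V \<subseteq> PiE I U" by (rule PiE_mono) (use V in blast)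
      ultimately show ?thesis using U(3) by (intro bexI[of _ "PiE I V"] conjI subset_trans[of "PiE I V" "PiE I U" W])
    qed
    show "\<exists>\<U>\<subseteq>?B. W = \<Union>\<U>"
    proof (intro exI[of _ "{V \<in> ?B. V \<subseteq> W}"] conjI)
      show "W = \<Union>{V \<in> ?B. V \<subseteq> W}"
      proof (intro equalityI subsetI)
        fix x assume "x \<in> W"
        then obtain V where "V \<in> ?B" "x \<in> V" "V \<subseteq> W" using * by metis
        then show "x \<in> \<Union>{V \<in> ?B. V \<subseteq> W}" by (intro UnionI[of V]) simp_all
      next
        fix x assume "x \<in> \<Union>{V \<in> ?B. V \<subseteq> W}"
        then show "x \<in> W" by (elim UnionE) (simp add: subset_iff)
      qed
    qed (rule Collect_restrict)
  qed
qed

lemma openin_PiE_product: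
  "finite I \<Longrightarrow> (\<And>i. i \<in> I \<Longrightarrow> openin (X i) (U i)) \<Longrightarrow> openin (product_topology X I) (PiE I U)"
  by (simp add: openin_PiE_gen)

lemma second_countable_product_topology:
  assumes I: "finite I" and sc: "\<And>i. i \<in> I \<Longrightarrow> second_countable (X i)"
  shows "second_countable (product_topology X I)"
proof -
  have "\<forall>i\<in>I. second_countable (X i)" using sc by blast
  from product_topology_countable_boxes[OF I this]
  obtain \<B> where B: "countable \<B>" "\<forall>V\<in>\<B>. \<exists>U. (\<forall>i\<in>I. openin (X i) (U i)) \<and> V = PiE I U"
    "\<forall>W. openin (product_topology X I) W \<longrightarrow> (\<exists>\<U>\<subseteq>\<B>. W = \<Union>\<U>)"
    by (elim exE conjE)
  show ?thesis
    unfolding second_countable_def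
  proof (intro exI[of _ \<B>] conjI ballI allI impI)
    show "openin (product_topology X I) V" if "V \<in> \<B>" for V
      using bspec[OF B(2) that] openin_PiE_product[OF I] by force
    show "\<exists>V\<in>\<B>. x \<in> V \<and> V \<subseteq> U" if "openin (product_topology X I) U \<and> x \<in> U" for U x
    proof -
      obtain \<U> where "\<U> \<subseteq> \<B>" "U = \<Union>\<U>" using B(3)[rule_format, of U] \<open>_ \<and> x \<in> U\<close> by (elim exE conjE) auto
      then show ?thesis using that by blast
    qed
  qed (rule B(1))
qed

text \<open>Continuity of the projections gives one inclusion. Second countability gives the other:
  an open set is a countable union of measurable boxes.\<close>

lemma sets_PiM_eq_borel_of_product:
  assumes I: "finite I" and sc: "\<And>i. i \<in> I \<Longrightarrow> second_countable (X i)"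
    and \<mu>: "\<And>i. i \<in> I \<Longrightarrow> sets (\<mu> i) = sets (borel_of (X i))"
  shows "sets (PiM I \<mu>) = sets (borel_of (product_topology X I))"
proof (rule antisym)
  have sp: "space (\<mu> i) = topspace (X i)" if "i \<in> I" for i
    using sets_eq_imp_space_eq[OF \<mu>[OF that]] by simp
  have spP: "(\<Pi>\<^sub>E i\<in>I. space (\<mu> i)) = topspace (product_topology X I)"
    using sp by (auto simp: PiE_iff)
  have meas: "(\<lambda>f. f i) \<in> measurable (borel_of (product_topology X I)) (\<mu> i)" if i: "i \<in> I" for i
  proof -
    have "(\<lambda>f. f i) \<in> measurable (borel_of (product_topology X I)) (borel_of (X i))"
      unfolding borel_of_def[of "X i"]
    proof (rule measurable_measure_of)
      fix U assume "U \<in> {U. openin (X i) U}"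
      then have "openin (product_topology X I) {x \<in> topspace (product_topology X I). x i \<in> U}"
        using i by (intro openin_continuous_map_preimage[OF continuous_map_product_projection]) auto
      also have "{x \<in> topspace (product_topology X I). x i \<in> U} =
          (\<lambda>f. f i) -` U \<inter> space (borel_of (product_topology X I))" by auto
      finally show "(\<lambda>f. f i) -` U \<inter> space (borel_of (product_topology X I)) \<in>
          sets (borel_of (product_topology X I))" by (rule borel_of_open)
    qed (use i in \<open>auto dest: openin_subset\<close>)
    then show ?thesis using measurable_cong_sets[OF refl \<mu>[OF i]] by blast
  qed
  show "sets (PiM I \<mu>) \<subseteq> sets (borel_of (product_topology X I))"
    unfolding sets_PiM_single
  proof (rule sets.sigma_sets_subset'[OF subsetI])
    fix Z assume "Z \<in> {{f \<in> \<Pi>\<^sub>E i\<in>I. space (\<mu> i). f i \<in> A} |i A. i \<in> I \<and> A \<in> sets (\<mu> i)}"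
    then obtain i A where i: "i \<in> I" "A \<in> sets (\<mu> i)" "Z = {f \<in> \<Pi>\<^sub>E i\<in>I. space (\<mu> i). f i \<in> A}" by blast
    have "Z = (\<lambda>f. f i) -` A \<inter> space (borel_of (product_topology X I))" using i spP by auto
    then show "Z \<in> sets (borel_of (product_topology X I))"
      using measurable_sets[OF meas[OF i(1)] i(2)] by simp
  next
    show "(\<Pi>\<^sub>E i\<in>I. space (\<mu> i)) \<in> sets (borel_of (product_topology X I))"
      unfolding spP by (rule borel_of_open) (rule openin_topspace)
  qed
  have "\<forall>i\<in>I. second_countable (X i)" using sc by blast
  from product_topology_countable_boxes[OF I this]
  obtain \<B> where B: "countable \<B>" "\<forall>V\<in>\<B>. \<exists>U. (\<forall>i\<in>I. openin (X i) (U i)) \<and> V = PiE I U"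
    "\<forall>W. openin (product_topology X I) W \<longrightarrow> (\<exists>\<U>\<subseteq>\<B>. W = \<Union>\<U>)"
    by (elim exE conjE)
  have box: "V \<in> sets (PiM I \<mu>)" if "V \<in> \<B>" for V
  proof -
    obtain U where "\<forall>i\<in>I. openin (X i) (U i)" "V = PiE I U" using bspec[OF B(2) \<open>V \<in> \<B>\<close>] by (elim exE conjE)
    then show ?thesis using I by (auto intro!: sets_PiM_I_finite simp: \<mu> borel_of_open)
  qed
  show "sets (borel_of (product_topology X I)) \<subseteq> sets (PiM I \<mu>)"
    unfolding sets_borel_of
  proof (rule sets.sigma_sets_subset'[OF subsetI])
    fix W assume "W \<in> {U. openin (product_topology X I) U}"
    then obtain \<U> where "\<U> \<subseteq> \<B>" "W = \<Union>\<U>" using B(3)[rule_format, of W] by auto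
    then show "W \<in> sets (PiM I \<mu>)"
      using box B(1) by (auto intro!: sets.countable_Union intro: countable_subset)
  next
    show "topspace (product_topology X I) \<in> sets (PiM I \<mu>)"
      using sets.top[of "PiM I \<mu>"] spP by (simp add: space_PiM)
  qed
qed

lemma (in finite_measure) measure_UN_tail:
  assumes A: "\<And>i::nat. A i \<in> sets M" and e: "e > 0"
  shows "\<exists>n. measure M ((\<Union>i. A i) - (\<Union>i<n. A i)) \<le> e"
proof -
  have "(\<lambda>n. measure M (\<Union>i<n. A i)) \<longlonglongrightarrow> measure M (\<Union>n. \<Union>i<n. A i)"
    by (rule finite_Lim_measure_incseq) (use A in \<open>auto simp: incseq_def intro: less_le_trans\<close>)
  moreover have "(\<Union>n. \<Union>i<n. A i) = (\<Union>i. A i)" by auto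
  ultimately obtain n where n: "\<bar>measure M (\<Union>i<n. A i) - measure M (\<Union>i. A i)\<bar> < e"
    using e LIMSEQ_D[of _ "measure M (\<Union>i. A i)" e] by fastforce
  have "measure M ((\<Union>i. A i) - (\<Union>i<n. A i)) = measure M (\<Union>i. A i) - measure M (\<Union>i<n. A i)"
    by (rule finite_measure_Diff) (use A in auto)
  then show ?thesis using n by (intro exI[of _ n]) linarith
qed

text \<open>In a metrizable space open sets are countable unions of closed sets, and two-sided
  approximation survives complements and countable unions; induction over the generated
  sigma-algebra covers all Borel sets.\<close>

lemma borel_closed_open_approximation:
  assumes T: "metrizable_space T" and M: "finite_measure M" and sets: "sets M = sets (borel_of T)"
    and A: "A \<in> sets M" and e: "e > 0"
  shows "\<exists>C U. closedin T C \<and> openin T U \<and> C \<subseteq> A \<and> A \<subseteq> U \<and> measure M (U - C) \<le> e"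
proof -
  interpret finite_measure M by fact
  have op: "U \<in> sets M" if "openin T U" for U using borel_of_open[OF that] sets by simp
  have cl: "U \<in> sets M" if "closedin T U" for U using borel_of_closed[OF that] sets by simp
  have "A \<in> sigma_sets (topspace T) {U. openin T U}" using A by (simp add: sets sets_borel_of)
  then have "\<forall>e>0. \<exists>C U. closedin T C \<and> openin T U \<and> C \<subseteq> A \<and> A \<subseteq> U \<and> measure M (U - C) \<le> e"
  proof (induction rule: sigma_sets.induct)
    case (Basic a)
    then have a: "openin T a" by simp
    then obtain C where C: "\<And>n::nat. closedin T (C n)" "\<Union>(range C) = a"
      using open_imp_fsigma_in[OF T a] unfolding fsigma_in_ascending by blast
    show ?case
    proof (intro allI impI)
      fix e :: real assume "e > 0"
      then obtain n where n: "measure M ((\<Union>i. C i) - (\<Union>i<n. C i)) \<le> e"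
        using measure_UN_tail[of C e] cl C(1) by blast
      show "\<exists>C U. closedin T C \<and> openin T U \<and> C \<subseteq> a \<and> a \<subseteq> U \<and> measure M (U - C) \<le> e"
        using n C a by (intro exI[of _ "\<Union>i<n. C i"] exI[of _ a]) (auto intro!: closedin_Union)
    qed
  next
    case Empty
    show ?case by (intro allI impI exI[of _ "{}"]) simp
  next
    case (Compl a)
    show ?case
    proof (intro allI impI)
      fix e :: real assume "e > 0"
      then obtain C U where CU: "closedin T C" "openin T U" "C \<subseteq> a" "a \<subseteq> U" "measure M (U - C) \<le> e"
        using Compl.IH by meson
      have "(topspace T - C) - (topspace T - U) = U - C" using openin_subset[OF CU(2)] by auto
      then show "\<exists>C U. closedin T C \<and> openin T U \<and> C \<subseteq> topspace T - a \<and> topspace T - a \<subseteq> U \<and>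
          measure M (U - C) \<le> e"
        using CU by (intro exI[of _ "topspace T - U"] exI[of _ "topspace T - C"]) auto
    qed
  next
    case (Union a)
    show ?case
    proof (intro allI impI)
      fix e :: real assume e: "e > 0"
      \<comment> \<open>The gaps cost e/2 in total, as (e/4)(1/2)^i sums to e/2. An infinite union
        of closed sets need not be closed, so only finitely many \<open>C i\<close> are kept, and
        dropping the others costs another e/2.\<close>
      have "\<exists>C U. closedin T C \<and> openin T U \<and> C \<subseteq> a i \<and> a i \<subseteq> U \<and> measure M (U - C) \<le> (e/4) * (1/2)^i" for i
        by (rule Union.IH[rule_format]) (use e in simp)
      then obtain C U where CU: "\<And>i. closedin T (C i)" "\<And>i. openin T (U i)" "\<And>i. C i \<subseteq> a i" "\<And>i. a i \<subseteq> U i"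
          "\<And>i. measure M (U i - C i) \<le> (e/4) * (1/2)^i" by metis
      obtain n where n: "measure M ((\<Union>i. C i) - (\<Union>i<n. C i)) \<le> e/2"
        using measure_UN_tail[of C "e/2"] cl CU(1) e by auto
      have sm: "summable (\<lambda>i. (e/4) * (1/2)^i)" by (intro summable_mult summable_geometric) simp
      have sm': "summable (\<lambda>i. measure M (U i - C i))"
        by (rule summable_comparison_test'[OF sm, of 0]) (use CU(5) in auto)
      have "measure M (\<Union>i. U i - C i) \<le> (\<Sum>i. measure M (U i - C i))"
        by (rule finite_measure_subadditive_countably) (use sm' op cl CU in auto)
      also have "\<dots> \<le> (\<Sum>i. (e/4) * (1/2)^i)" by (rule suminf_le[OF CU(5) sm' sm])
      also have "\<dots> = e/2" by (subst suminf_mult) (auto simp: suminf_geometric)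
      finally have u: "measure M (\<Union>i. U i - C i) \<le> e/2" .
      have "measure M ((\<Union>i. U i) - (\<Union>i<n. C i)) \<le>
          measure M ((\<Union>i. U i - C i) \<union> ((\<Union>i. C i) - (\<Union>i<n. C i)))"
        by (rule finite_measure_mono) (use op cl CU in auto)
      also have "\<dots> \<le> measure M (\<Union>i. U i - C i) + measure M ((\<Union>i. C i) - (\<Union>i<n. C i))"
        by (rule measure_Un_le) (use op cl CU in auto)
      finally have "measure M ((\<Union>i. U i) - (\<Union>i<n. C i)) \<le> e" using u n by linarith
      then show "\<exists>C U. closedin T C \<and> openin T U \<and> C \<subseteq> (\<Union>i. a i) \<and> (\<Union>i. a i) \<subseteq> U \<and>
          measure M (U - C) \<le> e"
        using CU by (intro exI[of _ "\<Union>i<n. C i"] exI[of _ "\<Union>i. U i"]) (auto intro!: closedin_Union; blast)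
    qed
  qed
  with e show ?thesis by blast
qed

text \<open>Ulam's theorem. At each scale finitely many closed balls around a dense sequence carry
  all but (e/2)(1/2)^n of the mass, losses that add up to e. The intersection over all scales is
  closed and totally bounded, hence compact by completeness.\<close>

lemma borel_tight:
  assumes T: "completely_metrizable_space T" and sc: "second_countable T"
    and M: "finite_measure M" and sets: "sets M = sets (borel_of T)" and e: "e > 0"
  shows "\<exists>K. compactin T K \<and> measure M (topspace T - K) \<le> e"
proof -
  interpret finite_measure M by fact
  obtain S d where S: "Metric_space S d" "Metric_space.mcomplete S d" "T = Metric_space.mtopology S d"
    using T unfolding completely_metrizable_space_def by blast
  interpret Metric_space S d by fact
  have top: "topspace T = S" by (simp add: S(3))
  have spM: "space M = S" using sets_eq_imp_space_eq[OF sets] by (simp add: top)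
  have cl: "C \<in> sets M" if "closedin T C" for C using borel_of_closed[OF that] sets by simp
  obtain D where D: "countable D" "D \<subseteq> S" "T closure_of D = S"
    using second_countable_imp_separable_space[OF sc] unfolding separable_space_def top by blast
  show ?thesis
  proof (cases "S = {}")
    case True
    then show ?thesis using e top by (intro exI[of _ "{}"]) auto
  next
    case False
    then have "D \<noteq> {}" using D(3) by auto
    define q where "q = from_nat_into D"
    have q: "range q = D" unfolding q_def by (rule range_from_nat_into[OF \<open>D \<noteq> {}\<close> D(1)])
    have qS: "q i \<in> S" for i using q D(2) by auto
    have cov: "\<exists>i. x \<in> mcball (q i) r" if x: "x \<in> S" and r: "r > 0" for x r
    proof -
      have "\<forall>r>0. \<exists>y\<in>D. y \<in> mball x r"
        using D(3) x unfolding S(3) metric_closure_of by auto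
      then obtain y where "y \<in> D" "y \<in> mball x r" using r by blast
      then obtain i where "q i \<in> mball x r" using q by auto
      then show ?thesis by (intro exI[of _ i]) (auto simp: commute)
    qed
    define r where "r n = 1 / real (Suc n)" for n
    have "\<exists>k. measure M (S - (\<Union>i<k. mcball (q i) (r n))) \<le> (e/2) * (1/2)^n" for n
    proof -
      have "(\<Union>i. mcball (q i) (r n)) = S" using cov[of _ "r n"] by (fastforce simp: r_def)
      then show ?thesis
        using measure_UN_tail[of "\<lambda>i. mcball (q i) (r n)" "(e/2) * (1/2)^n"] e cl S(3) by simp
    qed
    then obtain k where k: "\<And>n. measure M (S - (\<Union>i<k n. mcball (q i) (r n))) \<le> (e/2) * (1/2)^n" by metis
    define F where "F n = (\<Union>i<k n. mcball (q i) (r n))" for n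
    define K where "K = S \<inter> (\<Inter>n. F n)"
    have Fcl: "closedin T (F n)" for n unfolding F_def S(3) by (intro closedin_Union) auto
    have Kcl: "closedin T K" unfolding K_def using Fcl closedin_topspace[of T] top
      by (intro closedin_Int) (auto intro!: closedin_INT)
    have tb: "mtotally_bounded K"
      unfolding mtotally_bounded_def
    proof (intro allI impI)
      fix \<epsilon> :: real assume "\<epsilon> > 0"
      then obtain n where n: "r n < \<epsilon> / 2" unfolding r_def by (meson half_gt_zero nat_approx_posE)
      \<comment> \<open>Total boundedness asks for centres inside \<open>K\<close>. Each ball
        meeting \<open>K\<close> is re-centred at a point of \<open>K\<close>, which doubles the
        radius and explains \<open>r n < \<epsilon> / 2\<close>.\<close>
      define c where "c i = (SOME x. x \<in> K \<inter> mcball (q i) (r n))" for i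
      define J where "J = {i. i < k n \<and> K \<inter> mcball (q i) (r n) \<noteq> {}}"
      have c: "c i \<in> K \<inter> mcball (q i) (r n)" if "i \<in> J" for i
        unfolding c_def by (rule someI_ex) (use that in \<open>auto simp: J_def\<close>)
      show "\<exists>K'. finite K' \<and> K' \<subseteq> K \<and> K \<subseteq> (\<Union>x\<in>K'. mball x \<epsilon>)"
      proof (intro exI[of _ "c ` J"] conjI subsetI)
        show "finite (c ` J)" by (simp add: J_def)
        show "x \<in> K" if "x \<in> c ` J" for x using that c by auto
        fix x assume x: "x \<in> K"
        then have "x \<in> F n" by (auto simp: K_def)
        then obtain i where i: "i < k n" "x \<in> mcball (q i) (r n)" by (auto simp: F_def)
        then have iJ: "i \<in> J" using x by (auto simp: J_def)
        have "d (c i) x \<le> d (c i) (q i) + d (q i) x" by (rule triangle) (use c[OF iJ] i qS in auto)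
        also have "\<dots> < \<epsilon>" using c[OF iJ] i n by (auto simp: commute)
        finally have "x \<in> mball (c i) \<epsilon>" using c[OF iJ] i by auto
        then show "x \<in> (\<Union>x\<in>c ` J. mball x \<epsilon>)" using iJ by blast
      qed
    qed
    have "compactin T K"
      using tb Kcl mtotally_bounded_eq_compact_closure_of[OF S(2), of K] closure_of_closedin[of T K] S(3) by simp
    moreover have "measure M (topspace T - K) \<le> e"
    proof -
      have sm: "summable (\<lambda>n. (e/2) * (1/2)^n)" by (intro summable_mult summable_geometric) simp
      have b: "measure M (S - F n) \<le> (e/2) * (1/2)^n" for n using k[of n] by (simp add: F_def)
      have meas: "S - F n \<in> sets M" for n using cl[OF Fcl[of n]] spM sets.compl_sets by metis
      have sm': "summable (\<lambda>n. measure M (S - F n))"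
        by (rule summable_comparison_test'[OF sm, of 0]) (use b in auto)
      have "topspace T - K = (\<Union>n. S - F n)" by (auto simp: K_def top)
      also have "measure M \<dots> \<le> (\<Sum>n. measure M (S - F n))"
        by (rule finite_measure_subadditive_countably) (use sm' meas in auto)
      also have "\<dots> \<le> (\<Sum>n. (e/2) * (1/2)^n)" by (rule suminf_le[OF b sm' sm])
      also have "\<dots> = e" by (subst suminf_mult) (auto simp: suminf_geometric)
      finally show ?thesis .
    qed
    ultimately show ?thesis by blast
  qed
qed

text \<open>A closed inner approximation is intersected with a compact set of almost full measure.
  The purpose is to replace the contact set by compact sets, which have compact, hence Borel,
  projections.\<close>

lemma borel_compact_approximation:
  assumes T: "completely_metrizable_space T" and sc: "second_countable T"
    and M: "finite_measure M" and sets: "sets M = sets (borel_of T)" and A: "A \<in> sets M" and e: "e > 0"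
  shows "\<exists>K. compactin T K \<and> K \<subseteq> A \<and> measure M (A - K) \<le> e"
proof -
  interpret finite_measure M by fact
  have sp: "space M = topspace T" using sets_eq_imp_space_eq[OF sets] by simp
  have op: "U \<in> sets M" if "openin T U" for U using borel_of_open[OF that] sets by simp
  have cl: "U \<in> sets M" if "closedin T U" for U using borel_of_closed[OF that] sets by simp
  have met: "metrizable_space T" by (rule completely_metrizable_imp_metrizable_space[OF T])
  obtain C U where CU: "closedin T C" "openin T U" "C \<subseteq> A" "A \<subseteq> U" "measure M (U - C) \<le> e/2"
    using borel_closed_open_approximation[OF met M sets A, of "e/2"] e by auto
  obtain K where K: "compactin T K" "measure M (topspace T - K) \<le> e/2"
    using borel_tight[OF T sc M sets, of "e/2"] e by auto
  have Kcl: "closedin T K" by (rule compactin_imp_closedin[OF metrizable_imp_Hausdorff_space[OF met] K(1)])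
  have "measure M (A - C \<inter> K) \<le> measure M ((U - C) \<union> (topspace T - K))"
    by (rule finite_measure_mono) (use CU A sets.sets_into_space[OF A] sp op cl Kcl sets.compl_sets[of K M] in auto)
  also have "\<dots> \<le> measure M (U - C) + measure M (topspace T - K)"
    by (rule measure_Un_le) (use CU sp op cl Kcl sets.compl_sets[of K M] in auto)
  finally have "measure M (A - C \<inter> K) \<le> e" using CU K by linarith
  moreover have "compactin T (C \<inter> K)" by (rule closed_Int_compactin[OF CU(1) K(1)])
  ultimately show ?thesis using CU by blast
qed

section \<open>Kantorovich duality\<close>

locale multimarginal =
  fixes N :: nat and X :: "nat \<Rightarrow> 'a metric" and \<mu> :: "nat \<Rightarrow> 'a measure"
    and c :: "(nat \<Rightarrow> 'a) \<Rightarrow> real" and a :: "nat \<Rightarrow> 'a \<Rightarrow> real"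
  assumes N_pos: "N \<ge> 1"
    and polish: "\<And>k. k \<in> {1..N} \<Longrightarrow> mcomplete_of (X k) \<and> separable_space (mtopology_of (X k))"
    and borel: "\<And>k. k \<in> {1..N} \<Longrightarrow> prob_space (\<mu> k) \<and> sets (\<mu> k) = sets (borel_of (mtopology_of (X k)))"
    and lsc: "lsc_top (product_topology (\<lambda>k. mtopology_of (X k)) {1..N}) c"
    and a_int: "\<And>k. k \<in> {1..N} \<Longrightarrow> integrable (\<mu> k) (a k)"
    and c_lb: "\<And>x. x \<in> PiE {1..N} (\<lambda>k. mspace (X k)) \<Longrightarrow> (\<Sum>k\<in>{1..N}. a k (x k)) \<le> c x"
begin

abbreviation prodtop :: "(nat \<Rightarrow> 'a) topology" where
  "prodtop \<equiv> product_topology (\<lambda>k. mtopology_of (X k)) {1..N}"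

abbreviation \<Omega> :: "(nat \<Rightarrow> 'a) set" where
  "\<Omega> \<equiv> PiE {1..N} (\<lambda>k. mspace (X k))"

definition integrable_family :: "(nat \<Rightarrow> 'a \<Rightarrow> real) \<Rightarrow> bool" where
  "integrable_family \<psi> \<longleftrightarrow> (\<forall>k\<in>{1..N}. integrable (\<mu> k) (\<psi> k))"

text \<open>The common integral of \<open>sep \<psi>\<close> under all plans, by the marginal
  conditions, and the objective of the dual problem.\<close>

definition val :: "(nat \<Rightarrow> 'a \<Rightarrow> real) \<Rightarrow> real" where
  "val \<psi> = (\<Sum>k\<in>{1..N}. \<integral>y. \<psi> k y \<partial>\<mu> k)"

definition sep :: "(nat \<Rightarrow> 'a \<Rightarrow> real) \<Rightarrow> (nat \<Rightarrow> 'a) \<Rightarrow> real" where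
  "sep \<psi> x = (\<Sum>k\<in>{1..N}. \<psi> k (x k))"

lemma topspace_prodtop: "topspace prodtop = \<Omega>"
  by simp

lemma space_\<mu>: "k \<in> {1..N} \<Longrightarrow> space (\<mu> k) = mspace (X k)"
  using borel[of k] sets_eq_imp_space_eq[of "\<mu> k"] by simp

lemma prob_\<mu>: "k \<in> {1..N} \<Longrightarrow> prob_space (\<mu> k)"
  using borel by simp

lemma space_PiM_\<mu>: "space (PiM {1..N} \<mu>) = \<Omega>"
  unfolding space_PiM by (rule PiE_cong) (rule space_\<mu>)

lemma second_countable_X: "k \<in> {1..N} \<Longrightarrow> second_countable (mtopology_of (X k))"
  using polish second_countable_mtopology_of by blast

lemma completely_metrizable_X: "k \<in> {1..N} \<Longrightarrow> completely_metrizable_space (mtopology_of (X k))"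
  using polish[of k] Metric_space.completely_metrizable_space_mtopology[OF Metric_space_mspace_mdist, of "X k"]
  by (simp add: mtopology_of_def mcomplete_of_def)

lemma second_countable_prodtop: "second_countable prodtop"
  by (rule second_countable_product_topology) (simp_all add: second_countable_X)

lemma completely_metrizable_prodtop: "completely_metrizable_space prodtop"
  unfolding completely_metrizable_space_product_topology
  by (intro disjI2 conjI ballI completely_metrizable_X countable_finite) auto

lemma sets_PiM_\<mu>: "sets (PiM {1..N} \<mu>) = sets (borel_of prodtop)"
  by (rule sets_PiM_eq_borel_of_product) (use borel second_countable_X in auto)

lemma c_measurable: "c \<in> borel_measurable (PiM {1..N} \<mu>)"
  unfolding borel_measurable_iff_greater
proof
  fix t
  have "openin prodtop {x \<in> topspace prodtop. t < c x}" using lsc unfolding lsc_top_def by blast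
  from borel_of_open[OF this]
  show "{x \<in> space (PiM {1..N} \<mu>). t < c x} \<in> sets (PiM {1..N} \<mu>)"
    unfolding sets_PiM_\<mu> space_PiM_\<mu> topspace_prodtop .
qed

lemma cylinder_measurable:
  assumes "k \<in> {1..N}" "A \<in> sets (\<mu> k)"
  shows "{x \<in> \<Omega>. x k \<in> A} \<in> sets (PiM {1..N} \<mu>)"
proof -
  have "{x \<in> \<Omega>. x k \<in> A} = (\<lambda>x. x k) -` A \<inter> space (PiM {1..N} \<mu>)" unfolding space_PiM_\<mu> by auto
  then show ?thesis
    using measurable_sets[OF measurable_component_singleton[OF assms(1), of \<mu>] assms(2)] by simp
qed

context
  fixes P assumes P: "P \<in> plans N \<mu>"
begin

lemma plan_sets: "sets P = sets (PiM {1..N} \<mu>)"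
  using P by (simp add: plans_def)

lemma plan_space: "space P = \<Omega>"
  using sets_eq_imp_space_eq[OF plan_sets] space_PiM_\<mu> by simp

lemma plan_proj: "k \<in> {1..N} \<Longrightarrow> (\<lambda>x. x k) \<in> measurable P (\<mu> k)"
  using measurable_component_singleton[of k "{1..N}" \<mu>] measurable_cong_sets[OF plan_sets refl] by blast

lemma plan_marginal: "k \<in> {1..N} \<Longrightarrow> distr P (\<mu> k) (\<lambda>x. x k) = \<mu> k"
  using P by (simp add: plans_def)

lemma plan_prob: "prob_space P"
proof -
  have 1: "1 \<in> {1..N}" using N_pos by simp
  have "prob_space (distr P (\<mu> 1) (\<lambda>x. x 1))" unfolding plan_marginal[OF 1] by (rule prob_\<mu>[OF 1])
  then show ?thesis using prob_space_distrD[OF plan_proj[OF 1]] by blast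
qed

lemma plan_integrable:
  fixes f :: "'a \<Rightarrow> real"
  assumes k: "k \<in> {1..N}" and f: "integrable (\<mu> k) f"
  shows "integrable P (\<lambda>x. f (x k))" and "(\<integral>x. f (x k) \<partial>P) = (\<integral>y. f y \<partial>\<mu> k)"
proof -
  have "integrable (distr P (\<mu> k) (\<lambda>x. x k)) f" using f by (simp add: plan_marginal[OF k])
  then show "integrable P (\<lambda>x. f (x k))" by (rule integrable_distr[OF plan_proj[OF k]])
  show "(\<integral>x. f (x k) \<partial>P) = (\<integral>y. f y \<partial>\<mu> k)"
    using integral_distr[OF plan_proj[OF k], of f] f plan_marginal[OF k] by auto
qed

lemma plan_sep:
  assumes "integrable_family \<psi>"
  shows "integrable P (sep \<psi>)" and "(\<integral>x. sep \<psi> x \<partial>P) = val \<psi>"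
proof -
  have i: "integrable P (\<lambda>x. \<psi> k (x k))" "(\<integral>x. \<psi> k (x k) \<partial>P) = (\<integral>y. \<psi> k y \<partial>\<mu> k)" if "k \<in> {1..N}" for k
    using plan_integrable[OF that, of "\<psi> k"] assms that by (auto simp: integrable_family_def)
  show "integrable P (sep \<psi>)" unfolding sep_def[abs_def] using i by auto
  show "(\<integral>x. sep \<psi> x \<partial>P) = val \<psi>" unfolding sep_def val_def using i by (simp add: integral_sum)
qed

end

text \<open>Constants are separated functions: each coordinate carries the share 1/N, and
  probability marginals give the total back.\<close>

lemma const_family:
  "integrable_family (\<lambda>k y. b / real N)" "val (\<lambda>k y. b / real N) = b" "sep (\<lambda>k y. b / real N) x = b"
proof -
  have ic: "(\<integral>y. b / real N \<partial>\<mu> k) = b / real N" if "k \<in> {1..N}" for k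
    using prob_space.prob_space[OF prob_\<mu>[OF that]] by simp
  have "val (\<lambda>k y. b / real N) = (\<Sum>k\<in>{1..N}. b / real N)"
    unfolding val_def by (intro sum.cong refl ic)
  then show "val (\<lambda>k y. b / real N) = b" using N_pos by simp
  show "integrable_family (\<lambda>k y. b / real N)" unfolding integrable_family_def
    using prob_\<mu> by (auto intro!: finite_measure.integrable_const prob_space.finite_measure)
  show "sep (\<lambda>k y. b / real N) x = b" unfolding sep_def using N_pos by simp
qed

lemma add_family:
  assumes "integrable_family \<psi>" "integrable_family \<eta>"
  shows "integrable_family (\<lambda>k y. \<psi> k y + \<eta> k y)" "val (\<lambda>k y. \<psi> k y + \<eta> k y) = val \<psi> + val \<eta>"
    "sep (\<lambda>k y. \<psi> k y + \<eta> k y) x = sep \<psi> x + sep \<eta> x"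
  using assms by (auto simp: integrable_family_def val_def sep_def sum.distrib)

lemma scale_family:
  assumes "integrable_family \<psi>"
  shows "integrable_family (\<lambda>k y. r * \<psi> k y)" "val (\<lambda>k y. r * \<psi> k y) = r * val \<psi>"
    "sep (\<lambda>k y. r * \<psi> k y) x = r * sep \<psi> x"
  using assms by (auto simp: integrable_family_def val_def sep_def sum_distrib_left)

lemma single_family:
  assumes k: "k \<in> {1..N}" and f: "integrable (\<mu> k) f"
  defines "\<psi> \<equiv> \<lambda>i y. if i = k then f y else 0"
  shows "integrable_family \<psi>" "val \<psi> = (\<integral>y. f y \<partial>\<mu> k)" "sep \<psi> x = f (x k)"
proof -
  show "integrable_family \<psi>" unfolding integrable_family_def
  proof
    show "integrable (\<mu> i) (\<psi> i)" for i using f by (cases "i = k") (auto simp: \<psi>_def)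
  qed
  have "val \<psi> = (\<Sum>i\<in>{1..N}. if i = k then (\<integral>y. f y \<partial>\<mu> k) else 0)"
    unfolding val_def \<psi>_def by (rule sum.cong) auto
  then show "val \<psi> = (\<integral>y. f y \<partial>\<mu> k)" using k by (simp add: sum.delta)
  show "sep \<psi> x = f (x k)" unfolding sep_def \<psi>_def using k by (simp add: sum.delta)
qed

section \<open>Superhedging prices and a finitely additive plan\<close>

definition bounded_funs :: "((nat \<Rightarrow> 'a) \<Rightarrow> real) set" where
  "bounded_funs = {f. \<exists>b. \<forall>x\<in>\<Omega>. \<bar>f x\<bar> \<le> b}"

lemma bounded_funsI: "(\<And>x. x \<in> \<Omega> \<Longrightarrow> \<bar>f x\<bar> \<le> b) \<Longrightarrow> f \<in> bounded_funs"
  by (auto simp: bounded_funs_def)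

lemma bounded_funsE:
  assumes "f \<in> bounded_funs"
  obtains b where "\<forall>x\<in>\<Omega>. \<bar>f x\<bar> \<le> b"
  using assms unfolding bounded_funs_def by blast

lemma function_subspace_bounded_funs: "function_subspace bounded_funs"
  unfolding function_subspace_def
proof (intro conjI ballI allI)
  show "(\<lambda>x. 0) \<in> bounded_funs" by (rule bounded_funsI[of _ 0]) simp
next
  fix f g assume f: "f \<in> bounded_funs" and g: "g \<in> bounded_funs"
  obtain b where b: "\<forall>x\<in>\<Omega>. \<bar>f x\<bar> \<le> b" by (rule bounded_funsE[OF f])
  note b = bspec[OF b]
  obtain b' where b': "\<forall>x\<in>\<Omega>. \<bar>g x\<bar> \<le> b'" by (rule bounded_funsE[OF g])
  note b' = bspec[OF b']
  show "(\<lambda>x. f x + g x) \<in> bounded_funs"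
  proof (rule bounded_funsI)
    fix x assume "x \<in> \<Omega>"
    then show "\<bar>f x + g x\<bar> \<le> b + b'" using b[of x] b'[of x] by linarith
  qed
next
  fix f and r :: real assume f: "f \<in> bounded_funs"
  obtain b where *: "\<forall>x\<in>\<Omega>. \<bar>f x\<bar> \<le> b" by (rule bounded_funsE[OF f])
  note * = bspec[OF *]
  show "(\<lambda>x. r * f x) \<in> bounded_funs"
    by (rule bounded_funsI[of _ "\<bar>r\<bar> * b"]) (unfold abs_mult, intro mult_left_mono * abs_ge_zero)
qed

text \<open>The price of superhedging a function by separated functions and by the cost itself, the latter
  being charged at \<open>D\<close>.  A linear functional below it is a finitely additive plan of cost at most \<open>D\<close>.\<close>

definition prices :: "real \<Rightarrow> ((nat \<Rightarrow> 'a) \<Rightarrow> real) \<Rightarrow> real set" where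
  "prices D f = {t * D + val \<psi> | t \<psi>. t \<ge> 0 \<and> integrable_family \<psi> \<and> (\<forall>x\<in>\<Omega>. f x \<le> t * c x + sep \<psi> x)}"

lemma pricesI:
  "t \<ge> 0 \<Longrightarrow> integrable_family \<psi> \<Longrightarrow> (\<And>x. x \<in> \<Omega> \<Longrightarrow> f x \<le> t * c x + sep \<psi> x) \<Longrightarrow> t * D + val \<psi> \<in> prices D f"
  unfolding prices_def by blast

lemma prices_add:
  assumes "u \<in> prices D f" "v \<in> prices D g"
  shows "u + v \<in> prices D (\<lambda>x. f x + g x)"
proof -
  obtain s \<psi> where 1: "u = s * D + val \<psi>" "s \<ge> 0" "integrable_family \<psi>"
    "\<And>x. x \<in> \<Omega> \<Longrightarrow> f x \<le> s * c x + sep \<psi> x" using assms(1) unfolding prices_def by blast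
  obtain t \<eta> where 2: "v = t * D + val \<eta>" "t \<ge> 0" "integrable_family \<eta>"
    "\<And>x. x \<in> \<Omega> \<Longrightarrow> g x \<le> t * c x + sep \<eta> x" using assms(2) unfolding prices_def by blast
  note fam = add_family[OF 1(3) 2(3)]
  have "(s + t) * D + val (\<lambda>k y. \<psi> k y + \<eta> k y) \<in> prices D (\<lambda>x. f x + g x)"
  proof (rule pricesI[OF _ fam(1)])
    fix x assume "x \<in> \<Omega>"
    from 1(4)[OF this] 2(4)[OF this]
    show "f x + g x \<le> (s + t) * c x + sep (\<lambda>k y. \<psi> k y + \<eta> k y) x"
      unfolding fam(3) by (simp add: algebra_simps)
  qed (use 1 2 in auto)
  then show ?thesis unfolding fam(2) 1 2 by (simp add: algebra_simps)
qed

lemma prices_scale: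
  assumes "u \<in> prices D f" "r > 0"
  shows "r * u \<in> prices D (\<lambda>x. r * f x)"
proof -
  obtain s \<psi> where 1: "u = s * D + val \<psi>" "s \<ge> 0" "integrable_family \<psi>"
    "\<And>x. x \<in> \<Omega> \<Longrightarrow> f x \<le> s * c x + sep \<psi> x" using assms(1) unfolding prices_def by blast
  note fam = scale_family[OF 1(3), of r]
  have "(r * s) * D + val (\<lambda>k y. r * \<psi> k y) \<in> prices D (\<lambda>x. r * f x)"
  proof (rule pricesI[OF _ fam(1)])
    fix x assume "x \<in> \<Omega>"
    from mult_left_mono[OF 1(4)[OF this], of r] assms(2)
    show "r * f x \<le> (r * s) * c x + sep (\<lambda>k y. r * \<psi> k y) x"
      unfolding fam(3) by (simp add: algebra_simps)
  qed (use 1 assms in auto)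
  then show ?thesis unfolding fam(2) 1 by (simp add: algebra_simps)
qed

lemma prices_nonempty: "f \<in> bounded_funs \<Longrightarrow> prices D f \<noteq> {}"
proof -
  assume f: "f \<in> bounded_funs"
  obtain b where b: "\<forall>x\<in>\<Omega>. \<bar>f x\<bar> \<le> b" by (rule bounded_funsE[OF f])
  note b = bspec[OF b]
  have "0 * D + val (\<lambda>k y. b / real N) \<in> prices D f"
  proof (rule pricesI[OF _ const_family(1)])
    show "f x \<le> 0 * c x + sep (\<lambda>k y. b / real N) x" if "x \<in> \<Omega>" for x
      unfolding const_family using b[OF that] by linarith
  qed simp
  then show ?thesis by blast
qed

text \<open>If \<open>t > 0\<close>, the family -(\<psi> + b/N)/t is dual admissible, so its value
  is at most \<open>D\<close>; if \<open>t = 0\<close>, the inequality is integrated against the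
  given plan. The bound on dual values thus excludes arbitrage and makes the infimum of the prices
  finite.\<close>

lemma prices_bounded_below:
  assumes P: "P \<in> plans N \<mu>" and D: "\<And>\<psi>. dual_adm N X \<mu> c \<psi> \<Longrightarrow> val \<psi> \<le> D"
    and b: "\<And>x. x \<in> \<Omega> \<Longrightarrow> \<bar>f x\<bar> \<le> b" and u: "u \<in> prices D f"
  shows "- b \<le> u"
proof -
  obtain t \<psi> where 1: "u = t * D + val \<psi>" "t \<ge> 0" "integrable_family \<psi>"
    "\<And>x. x \<in> \<Omega> \<Longrightarrow> f x \<le> t * c x + sep \<psi> x" using u unfolding prices_def by blast
  define \<eta> where "\<eta> = (\<lambda>k y. \<psi> k y + b / real N)"
  have \<eta>: "integrable_family \<eta>" "val \<eta> = val \<psi> + b" "\<And>x. sep \<eta> x = sep \<psi> x + b"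
    unfolding \<eta>_def using add_family[OF 1(3) const_family(1)] const_family by auto
  have ge: "0 \<le> t * c x + sep \<eta> x" if "x \<in> \<Omega>" for x
    using 1(4)[OF that] b[OF that] \<eta>(3)[of x] by linarith
  show ?thesis
  proof (cases "t = 0")
    case True
    have "0 \<le> (\<integral>x. sep \<eta> x \<partial>P)"
      by (rule integral_nonneg_AE) (use ge True plan_space[OF P] in \<open>auto intro!: AE_I2\<close>)
    then show ?thesis using True 1(1) \<eta>(2) plan_sep[OF P \<eta>(1)] by simp
  next
    case False
    then have t: "t > 0" using 1 by simp
    note fam = scale_family[OF \<eta>(1), of "- (1 / t)"]
    have "dual_adm N X \<mu> c (\<lambda>k y. - (1 / t) * \<eta> k y)"
      unfolding dual_adm_def
    proof (intro conjI ballI)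
      show "integrable (\<mu> k) (\<lambda>y. - (1 / t) * \<eta> k y)" if "k \<in> {1..N}" for k
        using fam(1) that unfolding integrable_family_def by blast
      show "(\<Sum>k\<in>{1..N}. - (1 / t) * \<eta> k (x k)) \<le> c x" if "x \<in> \<Omega>" for x
      proof -
        have "sep (\<lambda>k y. - (1 / t) * \<eta> k y) x \<le> c x"
          unfolding fam(3) using ge[OF that] t by (simp add: field_simps)
        then show ?thesis unfolding sep_def .
      qed
    qed
    from D[OF this] have "- (1 / t) * val \<eta> \<le> D" unfolding fam(2) .
    then show ?thesis using t 1(1) \<eta>(2) by (simp add: field_simps)
  qed
qed

text \<open>Hahn-Banach is applied to the infimum of the prices. In the last property,
  \<open>t = 0\<close> with both signs of a separated \<open>f\<close> forces the prescribed
  marginals, while \<open>t = 1\<close> with zero \<psi> says that bounded functions below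
  \<open>c\<close> have value at most \<open>D\<close>.\<close>

lemma finitely_additive_plan_exists:
  assumes P: "P \<in> plans N \<mu>" and D: "\<And>\<psi>. dual_adm N X \<mu> c \<psi> \<Longrightarrow> val \<psi> \<le> D"
  obtains L where "\<And>f g. f \<in> bounded_funs \<Longrightarrow> g \<in> bounded_funs \<Longrightarrow> L (\<lambda>x. f x + g x) = L f + L g"
    and "\<And>f r. f \<in> bounded_funs \<Longrightarrow> L (\<lambda>x. r * f x) = r * L f"
    and "\<And>f \<psi> t. f \<in> bounded_funs \<Longrightarrow> t \<ge> 0 \<Longrightarrow> integrable_family \<psi> \<Longrightarrow>
          (\<And>x. x \<in> \<Omega> \<Longrightarrow> f x \<le> t * c x + sep \<psi> x) \<Longrightarrow> L f \<le> t * D + val \<psi>"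
proof -
  define q where "q f = Inf (prices D f)" for f
  have lower: "q f \<le> u" if f: "f \<in> bounded_funs" and u: "u \<in> prices D f" for f u
  proof -
    obtain b where b: "\<forall>x\<in>\<Omega>. \<bar>f x\<bar> \<le> b" by (rule bounded_funsE[OF f])
  note b = bspec[OF b]
    have "bdd_below (prices D f)"
      by (rule bdd_belowI[of _ "- b"]) (rule prices_bounded_below[OF P D b])
    then show ?thesis unfolding q_def by (rule cInf_lower[OF u])
  qed
  have geI: "v \<le> q f" if "f \<in> bounded_funs" "\<And>u. u \<in> prices D f \<Longrightarrow> v \<le> u" for f v
    unfolding q_def by (rule cInf_greatest[OF prices_nonempty[OF that(1)] that(2)])
  note B = function_subspace_bounded_funs
  have hom: "q (\<lambda>x. r * f x) \<le> r * q f" if f: "f \<in> bounded_funs" and r: "r > 0" for f r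
  proof -
    have "q (\<lambda>x. r * f x) / r \<le> q f"
    proof (rule geI[OF f])
      fix u assume "u \<in> prices D f"
      from lower[OF function_subspace_scale[OF B f] prices_scale[OF this r]]
      show "q (\<lambda>x. r * f x) / r \<le> u" using r by (simp add: field_simps)
    qed
    then show ?thesis using r by (simp add: field_simps)
  qed
  have "sublinear_on bounded_funs q"
    unfolding sublinear_on_def
  proof (intro conjI ballI allI impI)
    fix f g assume f: "f \<in> bounded_funs" and g: "g \<in> bounded_funs"
    have "q (\<lambda>x. f x + g x) - q g \<le> q f"
    proof (rule geI[OF f])
      fix u assume u: "u \<in> prices D f"
      have "q (\<lambda>x. f x + g x) - u \<le> q g"
      proof (rule geI[OF g])
        fix v assume v: "v \<in> prices D g"
        from lower[OF function_subspace_add[OF B f g] prices_add[OF u v]]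
        show "q (\<lambda>x. f x + g x) - u \<le> v" by linarith
      qed
      then show "q (\<lambda>x. f x + g x) - q g \<le> u" by linarith
    qed
    then show "q (\<lambda>x. f x + g x) \<le> q f + q g" by linarith
  next
    fix f and r :: real assume f: "f \<in> bounded_funs" and r: "r > 0"
    have "q (\<lambda>x. inverse r * (r * f x)) \<le> inverse r * q (\<lambda>x. r * f x)"
      by (rule hom[OF function_subspace_scale[OF B f]]) (use r in simp)
    then have "r * q f \<le> q (\<lambda>x. r * f x)" using r by (simp add: field_simps)
    with hom[OF f r] show "q (\<lambda>x. r * f x) = r * q f" by linarith
  qed
  then show thesis
  proof (rule sublinear_dominates_linear[OF B])
    fix L assume L: "\<And>f g. f \<in> bounded_funs \<Longrightarrow> g \<in> bounded_funs \<Longrightarrow> L (\<lambda>x. f x + g x) = L f + L g"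
    "\<And>f r. f \<in> bounded_funs \<Longrightarrow> L (\<lambda>x. r * f x) = r * L f" "\<And>f. f \<in> bounded_funs \<Longrightarrow> L f \<le> q f"
    show thesis
    proof (rule that[OF L(1,2)])
      fix f \<psi> and t :: real
      assume f: "f \<in> bounded_funs" and t: "t \<ge> 0" and \<psi>: "integrable_family \<psi>"
        and le: "\<And>x. x \<in> \<Omega> \<Longrightarrow> f x \<le> t * c x + sep \<psi> x"
      have "L f \<le> q f" by (rule L(3)[OF f])
      also have "\<dots> \<le> t * D + val \<psi>" by (rule lower[OF f pricesI[OF t \<psi> le]])
      finally show "L f \<le> t * D + val \<psi>" .
    qed
  qed
qed

end

text \<open>A layer-cake sum: \<open>h\<close> times the number of levels h, ..., K h strictly below
  \<open>y\<close>. Starting at level h instead of 0 keeps the sum below \<open>y\<close>; up to the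
  cap K h it loses at most one mesh.\<close>

lemma step_function_bounds:
  fixes y h :: real
  assumes "h > 0" "y \<ge> 0"
  shows "(\<Sum>i\<in>{1..K}. h * indicator {real i * h <..} y) \<le> y"
    and "min y (real K * h) - h \<le> (\<Sum>i\<in>{1..K}. h * indicator {real i * h <..} y)"
proof -
  define s where "s K = (\<Sum>i\<in>{1..K}. h * indicator {real i * h <..} y)" for K :: nat
  \<comment> \<open>Either all levels so far are below \<open>y\<close> and the sum is exactly K h,
    or \<open>y\<close> has been reached and the sum stays frozen within \<open>h\<close> below
    it.\<close>
  have "(real K * h < y \<and> s K = real K * h) \<or> (real K * h \<ge> y \<and> y - h \<le> s K \<and> s K \<le> y)" for K
  proof (induction K)
    case 0
    show ?case using assms by (auto simp: s_def)
  next
    case (Suc K)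
    have "s (Suc K) = s K + h * indicator {real (Suc K) * h <..} y" by (simp add: s_def)
    moreover have "real (Suc K) * h = real K * h + h" by (simp add: algebra_simps)
    ultimately show ?case using Suc assms(1) by (auto simp: indicator_def)
  qed
  then show "(\<Sum>i\<in>{1..K}. h * indicator {real i * h <..} y) \<le> y"
    "min y (real K * h) - h \<le> (\<Sum>i\<in>{1..K}. h * indicator {real i * h <..} y)"
    using assms(1) unfolding s_def[symmetric] by (smt (verit))+
qed

section \<open>A countably additive plan below the finitely additive one\<close>

locale finitely_additive_plan = multimarginal +
  fixes L :: "((nat \<Rightarrow> 'a) \<Rightarrow> real) \<Rightarrow> real" and D :: real
  assumes L_add: "\<And>f g. f \<in> bounded_funs \<Longrightarrow> g \<in> bounded_funs \<Longrightarrow> L (\<lambda>x. f x + g x) = L f + L g"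
    and L_scale: "\<And>f r. f \<in> bounded_funs \<Longrightarrow> L (\<lambda>x. r * f x) = r * L f"
    and L_le: "\<And>f \<psi> t. f \<in> bounded_funs \<Longrightarrow> t \<ge> 0 \<Longrightarrow> integrable_family \<psi> \<Longrightarrow>
          (\<And>x. x \<in> \<Omega> \<Longrightarrow> f x \<le> t * c x + sep \<psi> x) \<Longrightarrow> L f \<le> t * D + val \<psi>"
begin

text \<open>Indicators of arbitrary sets are bounded functions, so no measurability is
  involved.\<close>

definition content :: "(nat \<Rightarrow> 'a) set \<Rightarrow> real" where
  "content E = L (indicator E)"

lemma indicator_bounded: "indicator E \<in> bounded_funs"
  by (rule bounded_funsI[of _ 1]) (simp add: indicator_def)

lemma scaled_indicator_bounded: "(\<lambda>x. r * indicator E x) \<in> bounded_funs"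
  by (rule function_subspace_scale[OF function_subspace_bounded_funs indicator_bounded])

lemma L_nonpos:
  assumes "f \<in> bounded_funs" "\<And>x. x \<in> \<Omega> \<Longrightarrow> f x \<le> 0"
  shows "L f \<le> 0"
proof -
  have "L f \<le> 0 * D + val (\<lambda>k y. 0 / real N)"
    by (rule L_le[OF assms(1) _ const_family(1)]) (unfold const_family(3), use assms(2) in simp_all)
  then show ?thesis unfolding const_family(2) by simp
qed

sublocale finite_content prodtop content
proof
  fix E :: "(nat \<Rightarrow> 'a) set"
  have "L (\<lambda>x. (-1) * indicator E x) \<le> 0"
    by (rule L_nonpos[OF scaled_indicator_bounded]) (simp add: indicator_def)
  then show "0 \<le> content E" unfolding content_def L_scale[OF indicator_bounded] by simp
  fix F assume "E \<inter> F = {}"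
  then have "indicator (E \<union> F) = (\<lambda>x. indicator E x + indicator F x :: real)"
    by (auto simp: indicator_def fun_eq_iff)
  then show "content (E \<union> F) = content E + content F"
    unfolding content_def using L_add[OF indicator_bounded indicator_bounded] by simp
qed

text \<open>The indicator of a cylinder and its negative are both separated. The hedging inequality
  with \<open>t = 0\<close>, used for \<open>r = 1\<close> and \<open>r = -1\<close>, gives the two
  bounds.\<close>

lemma content_cylinder:
  assumes k: "k \<in> {1..N}" and A: "A \<in> sets (\<mu> k)"
  shows "content {x \<in> \<Omega>. x k \<in> A} = measure (\<mu> k) A"
proof -
  interpret prob_space "\<mu> k" by (rule prob_\<mu>[OF k])
  have i: "integrable (\<mu> k) (\<lambda>y. r * indicator A y)" for r :: real
    using A by (intro integrable_mult_right integrable_real_indicator) (auto simp: less_top[symmetric])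
  have v: "(\<integral>y. r * indicator A y \<partial>\<mu> k) = r * measure (\<mu> k) A" for r :: real
    using A sets.sets_into_space[OF A] by (simp add: Int_absorb2)
  have "L (\<lambda>x. r * indicator {x \<in> \<Omega>. x k \<in> A} x) \<le> r * measure (\<mu> k) A" for r :: real
  proof -
    note fam = single_family[OF k i[of r]]
    have "L (\<lambda>x. r * indicator {x \<in> \<Omega>. x k \<in> A} x) \<le> 0 * D + val (\<lambda>j y. if j = k then r * indicator A y else 0)"
      by (rule L_le[OF scaled_indicator_bounded _ fam(1)]) (unfold fam(3), simp_all add: indicator_def)
    then show ?thesis unfolding fam(2) v by simp
  qed
  from this[of 1] this[of "-1"] show ?thesis
    unfolding content_def L_scale[OF indicator_bounded] by simp
qed

text \<open>Tightness is inherited from the marginals: each coordinate may lose mass e/N outside a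
  compact set, and the product of these sets is compact.\<close>

lemma content_tight:
  assumes "e > 0"
  shows "\<exists>K. compactin prodtop K \<and> content (topspace prodtop - K) \<le> e"
proof -
  have e: "e / N > 0" using assms N_pos by simp
  have "\<forall>k\<in>{1..N}. \<exists>K. compactin (mtopology_of (X k)) K \<and> measure (\<mu> k) (topspace (mtopology_of (X k)) - K) \<le> e / N"
    using borel_tight[OF completely_metrizable_X second_countable_X _ _ e] borel prob_space.finite_measure by blast
  from bchoice[OF this] obtain K where K: "\<forall>k\<in>{1..N}. compactin (mtopology_of (X k)) (K k) \<and>
      measure (\<mu> k) (topspace (mtopology_of (X k)) - K k) \<le> e / N" ..
  have meas: "mspace (X k) - K k \<in> sets (\<mu> k)" if k: "k \<in> {1..N}" for k
  proof -
    have "closedin (mtopology_of (X k)) (K k)"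
      using K k completely_metrizable_X[OF k] completely_metrizable_imp_metrizable_space
        metrizable_imp_Hausdorff_space compactin_imp_closedin by blast
    then have "K k \<in> sets (\<mu> k)" using borel[OF k] borel_of_closed by blast
    then show ?thesis using sets.compl_sets space_\<mu>[OF k] by metis
  qed
  have comp: "compactin prodtop (PiE {1..N} K)" unfolding compactin_PiE using K by blast
  have "\<Omega> - PiE {1..N} K \<subseteq> (\<Union>k\<in>{1..N}. {x \<in> \<Omega>. x k \<in> mspace (X k) - K k})"
  proof
    fix x assume x: "x \<in> \<Omega> - PiE {1..N} K"
    then obtain k where "k \<in> {1..N}" "x k \<notin> K k" by (auto simp: PiE_iff)
    moreover have "x k \<in> mspace (X k)" using x \<open>k \<in> {1..N}\<close> by (auto simp: PiE_iff)
    ultimately show "x \<in> (\<Union>k\<in>{1..N}. {x \<in> \<Omega>. x k \<in> mspace (X k) - K k})" using x by blast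
  qed
  then have "content (\<Omega> - PiE {1..N} K) \<le> content (\<Union>k\<in>{1..N}. {x \<in> \<Omega>. x k \<in> mspace (X k) - K k})"
    by (rule mono) auto
  also have "\<dots> \<le> (\<Sum>k\<in>{1..N}. content {x \<in> \<Omega>. x k \<in> mspace (X k) - K k})"
    by (rule subadditive_UN) auto
  also have "\<dots> = (\<Sum>k\<in>{1..N}. measure (\<mu> k) (mspace (X k) - K k))"
    by (rule sum.cong[OF refl content_cylinder]) (use meas in auto)
  also have "\<dots> \<le> (\<Sum>k\<in>{1..N}. e / N)" by (rule sum_mono) (use K in auto)
  also have "\<dots> = e" using N_pos by simp
  finally show ?thesis using comp unfolding topspace_prodtop by blast
qed

text \<open>The content of a cylinder is the marginal mass of its base, so a closed-open
  approximation in \<open>X k\<close> pulls back along the continuous projection with the same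
  error.\<close>

lemma cylinder_regular:
  assumes k: "k \<in> {1..N}" and A: "A \<in> sets (\<mu> k)"
  shows "{x \<in> \<Omega>. x k \<in> A} \<in> content_regular prodtop content"
  unfolding content_regular_def
proof (intro CollectI conjI allI impI)
  show "{x \<in> \<Omega>. x k \<in> A} \<subseteq> topspace prodtop" by auto
  fix e :: real assume e: "e > 0"
  have "\<exists>C U. closedin (mtopology_of (X k)) C \<and> openin (mtopology_of (X k)) U \<and> C \<subseteq> A \<and> A \<subseteq> U \<and>
      measure (\<mu> k) (U - C) \<le> e"
    by (rule borel_closed_open_approximation[OF _ _ _ A e])
      (use borel[OF k] completely_metrizable_X[OF k] completely_metrizable_imp_metrizable_space
        prob_space.finite_measure in blast)+
  then obtain C U where CU: "closedin (mtopology_of (X k)) C" "openin (mtopology_of (X k)) U" "C \<subseteq> A" "A \<subseteq> U"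
      "measure (\<mu> k) (U - C) \<le> e" by blast
  have cont: "continuous_map prodtop (mtopology_of (X k)) (\<lambda>x. x k)"
    by (rule continuous_map_product_projection[OF k])
  have "U - C \<in> sets (\<mu> k)" using borel[OF k] borel_of_open[OF CU(2)] borel_of_closed[OF CU(1)] by blast
  from content_cylinder[OF k this] CU(5)
  have "content {x \<in> \<Omega>. x k \<in> U - C} \<le> e" by simp
  moreover have "{x \<in> \<Omega>. x k \<in> U} - {x \<in> \<Omega>. x k \<in> C} = {x \<in> \<Omega>. x k \<in> U - C}" by auto
  moreover have "closedin prodtop {x \<in> \<Omega>. x k \<in> C}"
    using closedin_continuous_map_preimage[OF cont CU(1)] unfolding topspace_prodtop .
  moreover have "openin prodtop {x \<in> \<Omega>. x k \<in> U}"
    using openin_continuous_map_preimage[OF cont CU(2)] unfolding topspace_prodtop .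
  ultimately show "\<exists>C U. closedin prodtop C \<and> openin prodtop U \<and> C \<subseteq> {x \<in> \<Omega>. x k \<in> A} \<and>
      {x \<in> \<Omega>. x k \<in> A} \<subseteq> U \<and> content (U - C) \<le> e"
    using CU(3,4) by (intro exI[of _ "{x \<in> \<Omega>. x k \<in> C}"] exI[of _ "{x \<in> \<Omega>. x k \<in> U}"]) auto
qed

lemma box_regular:
  assumes "\<And>k. k \<in> {1..N} \<Longrightarrow> A k \<in> sets (\<mu> k)"
  shows "PiE {1..N} A \<in> content_regular prodtop content"
proof -
  interpret A: algebra "topspace prodtop" "content_regular prodtop content" by (rule algebra_content_regular)
  have "(\<Inter>k\<in>{1..N}. {x \<in> \<Omega>. x k \<in> A k}) \<in> content_regular prodtop content"
    by (rule A.finite_INT) (use N_pos assms cylinder_regular in auto)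
  also have "(\<Inter>k\<in>{1..N}. {x \<in> \<Omega>. x k \<in> A k}) = PiE {1..N} A"
  proof (intro equalityI subsetI)
    fix x assume x: "x \<in> (\<Inter>k\<in>{1..N}. {x \<in> \<Omega>. x k \<in> A k})"
    moreover have "1 \<in> {1..N}" using N_pos by simp
    ultimately have "x \<in> \<Omega>" by blast
    with x show "x \<in> PiE {1..N} A" by (auto simp: PiE_iff)
  next
    fix x assume x: "x \<in> PiE {1..N} A"
    have "A k \<subseteq> mspace (X k)" if "k \<in> {1..N}" for k
      using sets.sets_into_space[OF assms[OF that]] space_\<mu>[OF that] by simp
    then have "PiE {1..N} A \<subseteq> \<Omega>" by (intro PiE_mono)
    with x have "x \<in> \<Omega>" by blast
    with x show "x \<in> (\<Inter>k\<in>{1..N}. {x \<in> \<Omega>. x k \<in> A k})"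
      by (intro INT_I CollectI conjI PiE_mem[OF x])
  qed
  finally show ?thesis .
qed

text \<open>The countably additive extension agrees with the content on boxes and their finite
  unions. An open set is an increasing limit of such unions, which gives the one-sided bound; the
  content itself may jump upwards in this limit.\<close>

lemma plan_extending_content:
  obtains P where "P \<in> plans N \<mu>" "\<And>W. openin prodtop W \<Longrightarrow> measure P W \<le> content W"
proof -
  interpret A: algebra "topspace prodtop" "content_regular prodtop content" by (rule algebra_content_regular)
  obtain Q where Q: "space Q = topspace prodtop" "sets Q = sigma_sets (topspace prodtop) (content_regular prodtop content)"
    "\<forall>E\<in>content_regular prodtop content. emeasure Q E = ennreal (content E)"
    using tight_content_extends[OF content_tight] by (metis (no_types, lifting))
  have reg: "E \<in> sets Q" if "E \<in> content_regular prodtop content" for E using that Q(2) by auto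
  have sub: "sets (PiM {1..N} \<mu>) \<subseteq> sets Q"
    unfolding sets_PiM_single
  proof (rule sets.sigma_sets_subset'[OF subsetI])
    fix Z assume "Z \<in> {{f \<in> \<Pi>\<^sub>E i\<in>{1..N}. space (\<mu> i). f i \<in> A} |i A. i \<in> {1..N} \<and> A \<in> sets (\<mu> i)}"
    then obtain i A where i: "i \<in> {1..N}" "A \<in> sets (\<mu> i)" "Z = {f \<in> space (PiM {1..N} \<mu>). f i \<in> A}"
      unfolding space_PiM by blast
    show "Z \<in> sets Q" unfolding i(3) space_PiM_\<mu> by (rule reg[OF cylinder_regular[OF i(1,2)]])
  next
    show "(\<Pi>\<^sub>E i\<in>{1..N}. space (\<mu> i)) \<in> sets Q"
      using sets.top[of Q] space_PiM_\<mu> unfolding Q(1) topspace_prodtop space_PiM by simp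
  qed
  \<comment> \<open>\<open>Q\<close> lives on the sigma-algebra generated by the regular sets, which
    contains the product sigma-algebra; the image under the identity restricts it to the
    latter.\<close>
  define P where "P = distr Q (PiM {1..N} \<mu>) (\<lambda>x. x)"
  have id: "(\<lambda>x. x) \<in> measurable Q (PiM {1..N} \<mu>)"
  proof (rule measurableI)
    show "x \<in> space (PiM {1..N} \<mu>)" if "x \<in> space Q" for x
      using that unfolding Q(1) topspace_prodtop space_PiM_\<mu> .
    show "(\<lambda>x. x) -` A \<inter> space Q \<in> sets Q" if "A \<in> sets (PiM {1..N} \<mu>)" for A
      using sub that by (simp add: subset_iff)
  qed
  have sP: "sets P = sets (PiM {1..N} \<mu>)" by (simp add: P_def)
  have spP: "space P = \<Omega>" unfolding P_def space_distr by (rule space_PiM_\<mu>)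
  have eP: "emeasure P E = ennreal (content E)"
    if "E \<in> sets (PiM {1..N} \<mu>)" "E \<in> content_regular prodtop content" for E
  proof -
    have "emeasure P E = emeasure Q ((\<lambda>x. x) -` E \<inter> space Q)"
      unfolding P_def by (rule emeasure_distr[OF id that(1)])
    also have "(\<lambda>x. x) -` E \<inter> space Q = E" using sets.sets_into_space[OF reg[OF that(2)]] by auto
    finally show ?thesis using Q(3) that(2) by simp
  qed
  have proj: "(\<lambda>x. x k) \<in> measurable P (\<mu> k)" if "k \<in> {1..N}" for k
    using measurable_component_singleton[OF that, of \<mu>] measurable_cong_sets[OF sP refl] by blast
  have plan: "P \<in> plans N \<mu>"
    unfolding plans_def
  proof (intro CollectI conjI ballI sP)
    fix k assume k: "k \<in> {1..N}"
    interpret prob_space "\<mu> k" by (rule prob_\<mu>[OF k])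
    show "distr P (\<mu> k) (\<lambda>x. x k) = \<mu> k"
    proof (rule measure_eqI)
      fix A assume "A \<in> sets (distr P (\<mu> k) (\<lambda>x. x k))"
      then have A: "A \<in> sets (\<mu> k)" by simp
      have "emeasure (distr P (\<mu> k) (\<lambda>x. x k)) A = emeasure P ((\<lambda>x. x k) -` A \<inter> space P)"
        by (rule emeasure_distr[OF proj[OF k] A])
      also have "(\<lambda>x. x k) -` A \<inter> space P = {x \<in> \<Omega>. x k \<in> A}" unfolding spP by auto
      also have "emeasure P \<dots> = ennreal (content {x \<in> \<Omega>. x k \<in> A})"
        by (rule eP[OF cylinder_measurable[OF k A] cylinder_regular[OF k A]])
      also have "\<dots> = emeasure (\<mu> k) A" unfolding content_cylinder[OF k A] by (rule emeasure_eq_measure[symmetric])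
      finally show "emeasure (distr P (\<mu> k) (\<lambda>x. x k)) A = emeasure (\<mu> k) A" .
    qed simp
  qed
  interpret P: prob_space P by (rule plan_prob[OF plan])
  have "measure P W \<le> content W" if W: "openin prodtop W" for W
  proof -
    have "\<forall>k\<in>{1..N}. second_countable (mtopology_of (X k))" using second_countable_X by blast
    from product_topology_countable_boxes[OF finite_atLeastAtMost this]
    obtain \<B> where B: "countable \<B>"
      "\<forall>V\<in>\<B>. \<exists>U. (\<forall>k\<in>{1..N}. openin (mtopology_of (X k)) (U k)) \<and> V = PiE {1..N} U"
      "\<forall>W. openin prodtop W \<longrightarrow> (\<exists>\<U>\<subseteq>\<B>. W = \<Union>\<U>)"
      by (elim exE conjE)
    obtain \<U> where \<U>: "\<U> \<subseteq> \<B>" "W = \<Union>\<U>" using B(3) W by blast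
    have Wsub: "W \<subseteq> topspace prodtop" by (rule openin_subset[OF W])
    show ?thesis
    \<comment> \<open>Enumeration by \<open>from_nat_into\<close> requires a nonempty
      family.\<close>
    proof (cases "\<U> = {}")
      case True
      then show ?thesis using \<U> nonneg[of W] by simp
    next
      case False
      have cU: "countable \<U>" using B(1) \<U>(1) countable_subset by blast
      define V where "V = from_nat_into \<U>"
      have V: "range V = \<U>" unfolding V_def by (rule range_from_nat_into[OF False cU])
      have Vr: "V i \<in> content_regular prodtop content" for i
      proof -
        have "V i \<in> \<B>" using V \<U>(1) by blast
        then obtain U where U: "\<forall>k\<in>{1..N}. openin (mtopology_of (X k)) (U k)" "V i = PiE {1..N} U" using B(2) by blast
        have "U k \<in> sets (\<mu> k)" if "k \<in> {1..N}" for k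
          using U(1) that borel[OF that] borel_of_open by blast
        then show ?thesis unfolding U(2) by (rule box_regular)
      qed
      have Vo: "openin prodtop (V i)" for i
      proof -
        have "V i \<in> \<B>" using V \<U>(1) by blast
        then obtain U where U: "\<forall>k\<in>{1..N}. openin (mtopology_of (X k)) (U k)" "V i = PiE {1..N} U" using B(2) by blast
        show ?thesis unfolding U(2) by (rule openin_PiE_product) (use U(1) in auto)
      qed
      have Vm: "V i \<in> sets P" for i using borel_of_open[OF Vo] sP sets_PiM_\<mu> by simp
      have fin: "measure P (\<Union>i<n. V i) \<le> content W" for n
      proof -
        have "(\<Union>i<n. V i) \<in> content_regular prodtop content" by (rule A.finite_UN) (use Vr in auto)
        moreover have "(\<Union>i<n. V i) \<in> sets (PiM {1..N} \<mu>)" using Vm sP by auto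
        ultimately have "emeasure P (\<Union>i<n. V i) = ennreal (content (\<Union>i<n. V i))" using eP by blast
        moreover have sub: "(\<Union>i<n. V i) \<subseteq> W" using V \<U>(2) by blast
        ultimately have "measure P (\<Union>i<n. V i) = content (\<Union>i<n. V i)"
          using nonneg[of "\<Union>i<n. V i"] Wsub by (simp add: measure_def)
        also have "\<dots> \<le> content W" by (rule mono[OF sub Wsub])
        finally show ?thesis .
      qed
      have "(\<lambda>n. measure P (\<Union>i<n. V i)) \<longlonglongrightarrow> measure P (\<Union>n. \<Union>i<n. V i)"
        by (rule P.finite_Lim_measure_incseq) (use Vm in \<open>auto simp: incseq_def intro: less_le_trans\<close>)
      moreover have "(\<Union>n. \<Union>i<n. V i) = W" using V \<U>(2) by auto
      ultimately show ?thesis using fin by (metis LIMSEQ_le_const2)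
    qed
  qed
  with plan show thesis by (rule that)
qed

end

section \<open>The cost of the countably additive plan\<close>

context finitely_additive_plan
begin

lemma L_sum_scaled_indicators:
  assumes "finite J"
  shows "(\<lambda>x. \<Sum>i\<in>J. h * indicator (W i) x) \<in> bounded_funs \<and>
    L (\<lambda>x. \<Sum>i\<in>J. h * indicator (W i) x) = (\<Sum>i\<in>J. h * content (W i))"
  using assms
proof (induction J rule: finite_induct)
  case empty
  have "(\<lambda>x. 0) \<in> bounded_funs" using function_subspace_bounded_funs by (simp add: function_subspace_def)
  with L_scale[OF this, of 0] show ?case by simp
next
  case (insert i J)
  then have J: "(\<lambda>x. \<Sum>i\<in>J. h * indicator (W i) x) \<in> bounded_funs"
    "L (\<lambda>x. \<Sum>i\<in>J. h * indicator (W i) x) = (\<Sum>i\<in>J. h * content (W i))" by auto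
  have eq: "(\<lambda>x. \<Sum>i\<in>insert i J. h * indicator (W i) x) =
      (\<lambda>x. h * indicator (W i) x + (\<Sum>i\<in>J. h * indicator (W i) x))"
    by (rule ext) (rule sum.insert[OF insert.hyps])
  show ?case
    unfolding eq
    using function_subspace_add[OF function_subspace_bounded_funs scaled_indicator_bounded[of h "W i"] J(1)]
      L_add[OF scaled_indicator_bounded[of h "W i"] J(1)] L_scale[OF indicator_bounded[of "W i"], of h] J(2) insert.hyps
    by (simp add: content_def)
qed

text \<open>The amount by which \<open>a k\<close> falls below -m. Adding all these tails to the
  cost restores the lower bound -N m, at a price that vanishes as m grows.\<close>

definition tail :: "nat \<Rightarrow> nat \<Rightarrow> 'a \<Rightarrow> real" where
  "tail m k y = max 0 (- real m - a k y)"

lemma tail_family: "integrable_family (tail m)"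
  unfolding integrable_family_def
proof
  fix k assume k: "k \<in> {1..N}"
  interpret prob_space "\<mu> k" by (rule prob_\<mu>[OF k])
  show "integrable (\<mu> k) (tail m k)" unfolding tail_def[abs_def] using a_int[OF k] by simp
qed

lemma sep_tail_nonneg: "0 \<le> sep (tail m) x"
  unfolding sep_def tail_def by (intro sum_nonneg) simp

lemma cost_plus_tail_ge:
  assumes "x \<in> \<Omega>"
  shows "- (real N * real m) \<le> c x + sep (tail m) x"
proof -
  have "- (real N * real m) = (\<Sum>k\<in>{1..N}. - real m)" by simp
  also have "\<dots> \<le> (\<Sum>k\<in>{1..N}. a k (x k) + tail m k (x k))" by (rule sum_mono) (simp add: tail_def)
  also have "\<dots> = (\<Sum>k\<in>{1..N}. a k (x k)) + sep (tail m) x" by (simp add: sum.distrib sep_def)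
  finally show ?thesis using c_lb[OF assms] by linarith
qed

text \<open>Each tail is dominated by \<bar>a k\<bar> and vanishes at a given point once m is at
  least -a k.\<close>

lemma val_tail_tendsto: "(\<lambda>m. val (tail m)) \<longlonglongrightarrow> 0"
proof -
  have "(\<lambda>m. \<integral>y. tail m k y \<partial>\<mu> k) \<longlonglongrightarrow> (\<integral>y. 0 \<partial>\<mu> k)" if k: "k \<in> {1..N}" for k
  proof (rule integral_dominated_convergence[where w="\<lambda>y. \<bar>a k y\<bar>"])
    show "integrable (\<mu> k) (\<lambda>y. \<bar>a k y\<bar>)" using a_int[OF k] by simp
    show "tail m k \<in> borel_measurable (\<mu> k)" for m
      using tail_family[of m] k by (auto simp: integrable_family_def)
    show "AE y in \<mu> k. (\<lambda>m. tail m k y) \<longlonglongrightarrow> 0"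
    proof (rule AE_I2)
      fix y
      obtain m0 :: nat where m0: "- a k y \<le> real m0" using real_arch_simple by blast
      show "(\<lambda>m. tail m k y) \<longlonglongrightarrow> 0"
        by (rule tendsto_eventually) (use m0 in \<open>auto simp: eventually_sequentially tail_def intro!: exI[of _ m0]\<close>)
    qed
    show "AE y in \<mu> k. norm (tail m k y) \<le> \<bar>a k y\<bar>" for m
      by (rule AE_I2) (auto simp: tail_def)
  qed simp
  then have "(\<lambda>m. val (tail m)) \<longlonglongrightarrow> (\<Sum>k\<in>{1..N}. \<integral>y. 0 \<partial>\<mu> k)"
    unfolding val_def by (intro tendsto_sum)
  then show ?thesis by simp
qed

text \<open>\<open>ennreal\<close> sends negative reals to 0, so an upper bound stated in
  \<open>ennreal\<close> can be read back as a real one only when its right-hand side is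
  nonnegative. The zero function, written as a scaled indicator to have its boundedness at hand, is
  hedged by \<open>c\<close>, the tails and the constant N m.\<close>

lemma truncated_cost_bound_nonneg: "0 \<le> real N * real m + D + val (tail m)"
proof -
  have "L (\<lambda>x. 0 * indicator {} x) \<le> 1 * D + val (\<lambda>k y. tail m k y + (real N * real m) / real N)"
  proof (rule L_le[OF scaled_indicator_bounded _ add_family(1)[OF tail_family const_family(1)]])
    show "0 * indicator {} x \<le> 1 * c x + sep (\<lambda>k y. tail m k y + (real N * real m) / real N) x"
      if "x \<in> \<Omega>" for x
      unfolding add_family(3)[OF tail_family const_family(1)] const_family(3)
      using cost_plus_tail_ge[OF that, of m] by simp
  qed simp
  then show ?thesis
    unfolding add_family(2)[OF tail_family const_family(1)] const_family(2) L_scale[OF indicator_bounded] by simp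
qed

text \<open>The truncated cost is approximated from below by step functions over its open superlevel
  sets. On these \<open>P\<close> is at most the content, so each step function costs no more under
  \<open>P\<close> than under \<open>L\<close>, where hedging by \<open>c\<close>, the tails and the
  constant \<open>M\<close> bounds it.\<close>

lemma truncated_cost_nn_integral_le:
  fixes m :: nat
  assumes P: "P \<in> plans N \<mu>" and open_le: "\<And>W. openin prodtop W \<Longrightarrow> measure P W \<le> content W"
  defines "M \<equiv> real N * real m"
  shows "(\<integral>\<^sup>+ x. ennreal (max (c x) (- M) + M) \<partial>P) \<le> ennreal (M + D + val (tail m))"
proof -
  interpret P: prob_space P by (rule plan_prob[OF P])
  have spP: "space P = \<Omega>" by (rule plan_space[OF P])
  define f where "f x = max (c x) (- M) + M" for x
  have M: "M \<ge> 0" by (simp add: M_def)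
  have f0: "f x \<ge> 0" for x by (simp add: f_def)
  define h where "h n = 1 / real (Suc n)" for n
  \<comment> \<open>With mesh 1/(n+1) and (n+1)^2 levels, the mesh tends to 0 while the top level
    n+1 tends to infinity.\<close>
  define K where "K n = Suc n * Suc n" for n
  define W where "W n i = {x \<in> \<Omega>. real i * h n < f x}" for n i
  have h: "h n > 0" for n by (simp add: h_def)
  have Kh: "real (K n) * h n = real (Suc n)" for n by (simp add: h_def K_def field_simps)
  have Wo: "openin prodtop (W n i)" for n i
  proof -
    \<comment> \<open>At a nonnegative level the truncation at -M does not alter the superlevel set,
      which is therefore one of \<open>c\<close> and open by lower semicontinuity.\<close>
    have "real i * h n \<ge> 0" using h[of n] by simp
    then have "W n i = {x \<in> topspace prodtop. real i * h n - M < c x}"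
      unfolding W_def topspace_prodtop f_def by (auto simp: max_def split: if_splits)
    then show ?thesis using lsc unfolding lsc_top_def by simp
  qed
  have Wm: "W n i \<in> sets P" for n i
    using borel_of_open[OF Wo] plan_sets[OF P] sets_PiM_\<mu> by simp
  define s where "s n x = (\<Sum>i\<in>{1..K n}. h n * indicator (W n i) x)" for n x
  have sf: "s n x = (\<Sum>i\<in>{1..K n}. h n * indicator {real i * h n <..} (f x))" if "x \<in> \<Omega>" for n x
    unfolding s_def W_def using that by (intro sum.cong refl) (simp add: indicator_def)
  have s_le: "s n x \<le> f x" if "x \<in> \<Omega>" for n x
    unfolding sf[OF that] by (rule step_function_bounds(1)[OF h f0])
  have s_ge: "min (f x) (real (Suc n)) - h n \<le> s n x" if "x \<in> \<Omega>" for n x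
    unfolding sf[OF that] using step_function_bounds(2)[OF h f0, of x "K n" n] unfolding Kh .
  have s0: "0 \<le> s n x" for n x unfolding s_def using h[of n] by (intro sum_nonneg) simp
  have sm: "s n \<in> borel_measurable P" for n unfolding s_def[abs_def] using Wm by measurable
  have lim: "(\<lambda>n. s n x) \<longlonglongrightarrow> f x" if x: "x \<in> \<Omega>" for x
  proof (rule tendsto_sandwich)
    obtain n0 :: nat where n0: "f x \<le> real n0" using real_arch_simple by blast
    show "\<forall>\<^sub>F n in sequentially. f x - h n \<le> s n x"
      unfolding eventually_sequentially
    proof (intro exI[of _ n0] allI impI)
      fix n assume "n \<ge> n0"
      then have "min (f x) (real (Suc n)) = f x" using n0 by simp
      then show "f x - h n \<le> s n x" using s_ge[OF x, of n] by simp
    qed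
    show "\<forall>\<^sub>F n in sequentially. s n x \<le> f x" using s_le[OF x] by simp
    have "(\<lambda>n. f x - h n) \<longlonglongrightarrow> f x - 0"
      unfolding h_def by (intro tendsto_diff tendsto_const LIMSEQ_Suc lim_1_over_n)
    then show "(\<lambda>n. f x - h n) \<longlonglongrightarrow> f x" by simp
  qed simp
  have bound: "(\<integral>\<^sup>+ x. ennreal (s n x) \<partial>P) \<le> ennreal (M + D + val (tail m))" for n
  proof -
    have Ls: "s n \<in> bounded_funs" "L (s n) = (\<Sum>i\<in>{1..K n}. h n * content (W n i))"
      using L_sum_scaled_indicators[of "{1..K n}" "h n" "W n"] unfolding s_def[abs_def] by auto
    have int: "integrable P (\<lambda>x. h n * indicator (W n i) x)" for i
      using Wm by (intro integrable_mult_right integrable_real_indicator) (auto simp: less_top[symmetric])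
    have "(\<integral>\<^sup>+ x. ennreal (s n x) \<partial>P) = ennreal (\<integral>x. s n x \<partial>P)"
    proof (rule nn_integral_eq_integral)
      show "integrable P (s n)" unfolding s_def[abs_def] by (rule Bochner_Integration.integrable_sum) (rule int)
    qed (simp add: s0)
    also have "(\<integral>x. s n x \<partial>P) = (\<Sum>i\<in>{1..K n}. \<integral>x. h n * indicator (W n i) x \<partial>P)"
      unfolding s_def by (rule Bochner_Integration.integral_sum) (rule int)
    also have "\<dots> = (\<Sum>i\<in>{1..K n}. h n * measure P (W n i))"
      using sets.sets_into_space[OF Wm] by (intro sum.cong refl) (simp add: Int_absorb2)
    also have "\<dots> \<le> (\<Sum>i\<in>{1..K n}. h n * content (W n i))"
      by (intro sum_mono mult_left_mono open_le Wo less_imp_le[OF h])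
    also have "\<dots> = L (s n)" by (rule Ls(2)[symmetric])
    also have "\<dots> \<le> 1 * D + val (\<lambda>k y. tail m k y + M / real N)"
    proof (rule L_le[OF Ls(1) _ add_family(1)[OF tail_family const_family(1)]])
      fix x assume x: "x \<in> \<Omega>"
      have "s n x \<le> max (c x) (- M) + M" using s_le[OF x] by (simp add: f_def)
      \<comment> \<open>Where c is at least -M, nonnegativity of the tails suffices; elsewhere the
        maximum is -M, which lies below the cost plus the tails.\<close>
      also have "\<dots> \<le> 1 * c x + (sep (tail m) x + M)"
        using cost_plus_tail_ge[OF x, of m] sep_tail_nonneg[of m x] by (simp add: M_def)
      also have "\<dots> = 1 * c x + sep (\<lambda>k y. tail m k y + M / real N) x"
        unfolding add_family(3)[OF tail_family const_family(1)] const_family(3) ..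
      finally show "s n x \<le> 1 * c x + sep (\<lambda>k y. tail m k y + M / real N) x" .
    qed simp
    also have "\<dots> = M + D + val (tail m)"
      unfolding add_family(2)[OF tail_family const_family(1)] const_family(2) by simp
    finally show ?thesis by (simp add: ennreal_leI)
  qed
  \<comment> \<open>The meshes 1/(n+1) are not nested, so \<open>s n\<close> need not increase with
    \<open>n\<close>; Fatou's lemma takes the place of monotone convergence.\<close>
  have "(\<integral>\<^sup>+ x. ennreal (f x) \<partial>P) = (\<integral>\<^sup>+ x. liminf (\<lambda>n. ennreal (s n x)) \<partial>P)"
  proof (rule nn_integral_cong)
    fix x assume "x \<in> space P"
    then have "(\<lambda>n. ennreal (s n x)) \<longlonglongrightarrow> ennreal (f x)" unfolding spP by (intro tendsto_ennrealI lim)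
    then show "ennreal (f x) = liminf (\<lambda>n. ennreal (s n x))"
      by (metis lim_imp_Liminf trivial_limit_sequentially)
  qed
  also have "\<dots> \<le> liminf (\<lambda>n. \<integral>\<^sup>+ x. ennreal (s n x) \<partial>P)"
    by (rule nn_integral_liminf) (use sm in measurable)
  also have "\<dots> \<le> liminf (\<lambda>n::nat. ennreal (M + D + val (tail m)))"
    by (rule Liminf_mono) (use bound in simp)
  also have "\<dots> = ennreal (M + D + val (tail m))" by (simp add: Liminf_const)
  finally show ?thesis by (simp add: f_def)
qed

text \<open>The plan is chosen before \<open>m\<close>, so the bound \<open>D + val (tail m)\<close>
  holds for every \<open>m\<close> and its limit is \<open>D\<close>. Integrability of
  \<open>c\<close> comes from the bounds \<open>sep a x \<le> c x \<le> f x\<close>.\<close>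

lemma plan_of_cost_le:
  shows "\<exists>P\<in>plans N \<mu>. integrable P c \<and> (\<integral>x. c x \<partial>P) \<le> D"
proof (rule plan_extending_content)
  fix P assume P: "P \<in> plans N \<mu>" and open_le: "\<And>W. openin prodtop W \<Longrightarrow> measure P W \<le> content W"
  interpret P: prob_space P by (rule plan_prob[OF P])
  have cm: "c \<in> borel_measurable P" using c_measurable measurable_cong_sets[OF plan_sets[OF P] refl] by blast
  have ai: "integrable_family a" using a_int by (simp add: integrable_family_def)
  have *: "integrable P c \<and> (\<integral>x. c x \<partial>P) \<le> D + val (tail m)" for m
  proof -
    define M where "M = real N * real m"
    define f where "f x = max (c x) (- M) + M" for x
    have le: "(\<integral>\<^sup>+ x. ennreal (f x) \<partial>P) \<le> ennreal (M + D + val (tail m))"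
      unfolding f_def M_def by (rule truncated_cost_nn_integral_le[OF P open_le])
    have fm: "f \<in> borel_measurable P" unfolding f_def[abs_def] using cm by measurable
    have f0: "f x \<ge> 0" for x by (simp add: f_def)
    have fi: "integrable P f"
      by (rule integrableI_nonneg[OF fm]) (use f0 le in \<open>auto intro: le_less_trans\<close>)
    have ci: "integrable P c"
    proof (rule Bochner_Integration.integrable_bound)
      show "integrable P (\<lambda>x. \<bar>f x\<bar> + \<bar>sep a x\<bar>)" using fi plan_sep(1)[OF P ai] by simp
      show "AE x in P. norm (c x) \<le> norm (\<bar>f x\<bar> + \<bar>sep a x\<bar>)"
      proof (rule AE_I2)
        fix x assume "x \<in> space P"
        then have "sep a x \<le> c x" using c_lb plan_space[OF P] by (simp add: sep_def)
        moreover have "M \<ge> 0" by (simp add: M_def)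
        ultimately show "norm (c x) \<le> norm (\<bar>f x\<bar> + \<bar>sep a x\<bar>)" by (auto simp: f_def)
      qed
    qed (rule cm)
    have "ennreal (\<integral>x. f x \<partial>P) \<le> ennreal (M + D + val (tail m))"
      using nn_integral_eq_integral[OF fi] f0 le by simp
    then have "(\<integral>x. f x \<partial>P) \<le> M + D + val (tail m)"
      using truncated_cost_bound_nonneg[of m] by (simp add: M_def ennreal_le_iff)
    moreover have "(\<integral>x. c x \<partial>P) \<le> (\<integral>x. f x - M \<partial>P)"
    proof (rule integral_mono[OF ci])
      show "integrable P (\<lambda>x. f x - M)" using fi by simp
    qed (simp add: f_def)
    moreover have "(\<integral>x. f x - M \<partial>P) = (\<integral>x. f x \<partial>P) - M"
      using fi by (simp add: P.prob_space)
    ultimately show ?thesis using ci by linarith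
  qed
  have "(\<lambda>m. D + val (tail m)) \<longlonglongrightarrow> D + 0" by (intro tendsto_intros val_tail_tendsto)
  then have "(\<integral>x. c x \<partial>P) \<le> D" using * by (intro LIMSEQ_le_const[of _ D]) auto
  then show ?thesis using P * by blast
qed

end

text \<open>When \<open>D\<close> is the value of a dual solution, weak duality bounds every cost
  below by \<open>D\<close>, so the plan obtained here closes the duality gap.\<close>

lemma (in multimarginal) kantorovich_duality:
  assumes P: "P \<in> plans N \<mu>" and D: "\<And>\<psi>. dual_adm N X \<mu> c \<psi> \<Longrightarrow> val \<psi> \<le> D"
  shows "\<exists>P\<in>plans N \<mu>. integrable P c \<and> (\<integral>x. c x \<partial>P) \<le> D"
proof (rule finitely_additive_plan_exists[OF P D])
  fix L assume L: "\<And>f g. f \<in> bounded_funs \<Longrightarrow> g \<in> bounded_funs \<Longrightarrow> L (\<lambda>x. f x + g x) = L f + L g"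
    "\<And>f r. f \<in> bounded_funs \<Longrightarrow> L (\<lambda>x. r * f x) = r * L f"
    "\<And>f \<psi> t. f \<in> bounded_funs \<Longrightarrow> t \<ge> 0 \<Longrightarrow> integrable_family \<psi> \<Longrightarrow>
          (\<And>x. x \<in> \<Omega> \<Longrightarrow> f x \<le> t * c x + sep \<psi> x) \<Longrightarrow> L f \<le> t * D + val \<psi>"
  interpret finitely_additive_plan N X \<mu> c a L D
    by unfold_locales (use L in blast)+
  show ?thesis by (rule plan_of_cost_le)
qed

section \<open>Marginals of optimal plans\<close>

text \<open>Preimages under \<open>f\<close> and \<open>g\<close> differ only inside a null set,
  which the completion absorbs. The intended \<open>f\<close> is the reduced cost.\<close>

lemma borel_measurable_completion_AE:
  fixes f g :: "'x \<Rightarrow> 'b::topological_space"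
  assumes g: "g \<in> borel_measurable M" and eq: "AE x in M. f x = g x"
  shows "f \<in> borel_measurable (completion M)"
proof (rule measurableI)
  obtain Z where Z: "{x \<in> space M. f x \<noteq> g x} \<subseteq> Z" "Z \<in> null_sets M"
    using eq by (auto elim!: AE_E)
  fix A :: "'b set" assume A: "A \<in> sets borel"
  show "f -` A \<inter> space (completion M) \<in> sets (completion M)"
  proof (rule sets_completionI)
    show "f -` A \<inter> space (completion M) = (g -` A \<inter> space M - Z) \<union> (f -` A \<inter> space M \<inter> Z)"
      using Z(1) by auto
    show "g -` A \<inter> space M - Z \<in> sets M" using measurable_sets[OF g A] Z(2) by auto
  qed (use Z in auto)
qed simp

locale dual_optimum = multimarginal +
  fixes \<phi> :: "nat \<Rightarrow> 'a \<Rightarrow> real"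
  assumes N2: "N \<ge> 2" and dual: "dual_sol N X \<mu> c \<phi>"
begin

lemma \<phi>_family: "integrable_family \<phi>"
  using dual by (simp add: dual_sol_def dual_adm_def integrable_family_def)

lemma sep_\<phi>_le: "x \<in> \<Omega> \<Longrightarrow> sep \<phi> x \<le> c x"
  using dual by (simp add: dual_sol_def dual_adm_def sep_def)

text \<open>Duality provides a plan of cost at most \<open>val \<phi>\<close>, and \<open>P\<close>
  costs no more. The function \<open>c - sep \<phi>\<close> is nonnegative, so its integral under
  \<open>P\<close> is 0 and it vanishes almost everywhere.\<close>

lemma complementary_slackness:
  assumes opt: "opt_MK N \<mu> c P"
  shows "AE x in P. c x = sep \<phi> x"
proof -
  have P: "P \<in> plans N \<mu>" and ci: "integrable P c" using opt by (auto simp: opt_MK_def)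
  have "val \<psi> \<le> val \<phi>" if "dual_adm N X \<mu> c \<psi>" for \<psi>
    using dual that by (simp add: dual_sol_def val_def)
  from kantorovich_duality[OF P this] obtain P' where
    P': "P' \<in> plans N \<mu>" "integrable P' c" "(\<integral>x. c x \<partial>P') \<le> val \<phi>" by blast
  have "(\<integral>x. c x \<partial>P) \<le> (\<integral>x. c x \<partial>P')" using opt P' by (auto simp: opt_MK_def)
  then have le: "(\<integral>x. c x \<partial>P) \<le> (\<integral>x. sep \<phi> x \<partial>P)" using P'(3) plan_sep(2)[OF P \<phi>_family] by simp
  note si = plan_sep(1)[OF P \<phi>_family]
  have nn: "AE x in P. 0 \<le> c x - sep \<phi> x"
    by (rule AE_I2) (use sep_\<phi>_le plan_space[OF P] in simp)
  have "(\<integral>x. c x - sep \<phi> x \<partial>P) = 0"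
    using le integral_nonneg_AE[OF nn] Bochner_Integration.integral_diff[OF ci si] by simp
  then have "AE x in P. c x - sep \<phi> x = 0"
    using integral_nonneg_eq_0_iff_AE[OF Bochner_Integration.integrable_diff[OF ci si] nn] by simp
  then show ?thesis by eventually_elim simp
qed

section \<open>Reduced costs and two-marginal problems\<close>

context
  fixes j assumes j: "j \<in> {2..N}"
begin

lemma jN: "j \<in> {1..N}" and one: "1 \<in> {1..N}" and j1: "j \<noteq> 1"
  using j N2 by auto

lemma sum_split_1j:
  fixes f :: "nat \<Rightarrow> real"
  shows "(\<Sum>k\<in>{1..N}. f k) = f 1 + f j + (\<Sum>k\<in>{1..N} - {1, j}. f k)"
proof -
  have "(\<Sum>k\<in>{1..N}. f k) = (\<Sum>k\<in>{1..N} - {1, j}. f k) + (\<Sum>k\<in>{1, j}. f k)"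
    by (rule sum.subset_diff) (use jN one in auto)
  then show ?thesis using j1 by simp
qed

lemma cost_1j_elements_ge:
  assumes "x1 \<in> mspace (X 1)" "xj \<in> mspace (X j)" "y \<in> PiE ({1..N} - {1, j}) (\<lambda>k. mspace (X k))"
  shows "\<phi> 1 x1 + \<phi> j xj \<le> c ((y(1 := x1))(j := xj)) - (\<Sum>k\<in>{1..N} - {1, j}. \<phi> k (y k))"
proof -
  let ?z = "(y(1 := x1))(j := xj)"
  have "?z \<in> \<Omega>" using assms jN one unfolding PiE_iff extensional_def by auto
  then have "sep \<phi> ?z \<le> c ?z" by (rule sep_\<phi>_le)
  moreover have "sep \<phi> ?z = \<phi> 1 x1 + \<phi> j xj + (\<Sum>k\<in>{1..N} - {1, j}. \<phi> k (?z k))"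
    unfolding sep_def sum_split_1j using j1 by simp
  moreover have "(\<Sum>k\<in>{1..N} - {1, j}. \<phi> k (?z k)) = (\<Sum>k\<in>{1..N} - {1, j}. \<phi> k (y k))"
    by (rule sum.cong) auto
  ultimately show ?thesis by simp
qed

lemma cost_1j_ge:
  assumes x: "x1 \<in> mspace (X 1)" "xj \<in> mspace (X j)"
  shows "\<phi> 1 x1 + \<phi> j xj \<le> cost_1j N X c \<phi> j x1 xj"
  unfolding cost_1j_def
proof (rule cInf_greatest)
  \<comment> \<open>\<open>Inf\<close> over the reals can be bounded below only for a nonempty set.
    A space carrying a probability measure is nonempty, so the remaining coordinates can be filled
    in.\<close>
  have "mspace (X k) \<noteq> {}" if "k \<in> {1..N}" for k
    using prob_space.not_empty[OF prob_\<mu>[OF that]] space_\<mu>[OF that] by simp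
  then have "PiE ({1..N} - {1, j}) (\<lambda>k. mspace (X k)) \<noteq> {}" unfolding PiE_eq_empty_iff by blast
  then show "{c (y(1 := x1, j := xj)) - (\<Sum>k\<in>{1..N} - {1, j}. \<phi> k (y k)) |y.
     y \<in> (\<Pi>\<^sub>E k\<in>{1..N} - {1, j}. mspace (X k))} \<noteq> {}" by blast
next
  fix v assume "v \<in> {c (y(1 := x1, j := xj)) - (\<Sum>k\<in>{1..N} - {1, j}. \<phi> k (y k)) |y.
     y \<in> (\<Pi>\<^sub>E k\<in>{1..N} - {1, j}. mspace (X k))}"
  then show "\<phi> 1 x1 + \<phi> j xj \<le> v" using cost_1j_elements_ge[OF x] by blast
qed

text \<open>At a contact point the remaining coordinates of \<open>x\<close> itself form a
  competitor in the infimum, with value exactly \<phi> 1 (x 1) + \<phi> j (x j).\<close>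

lemma cost_1j_le:
  assumes x: "x \<in> \<Omega>" and eq: "c x = sep \<phi> x"
  shows "cost_1j N X c \<phi> j (x 1) (x j) \<le> \<phi> 1 (x 1) + \<phi> j (x j)"
proof -
  let ?y = "restrict x ({1..N} - {1, j})"
  let ?S = "{c (y(1 := x 1, j := x j)) - (\<Sum>k\<in>{1..N} - {1, j}. \<phi> k (y k)) |y.
     y \<in> (\<Pi>\<^sub>E k\<in>{1..N} - {1, j}. mspace (X k))}"
  have x1j: "x 1 \<in> mspace (X 1)" "x j \<in> mspace (X j)" using PiE_mem[OF x] one jN by blast+
  have "?y(1 := x 1, j := x j) = x"
    using x one jN unfolding PiE_iff extensional_def by (auto simp: fun_eq_iff)
  moreover have "(\<Sum>k\<in>{1..N} - {1, j}. \<phi> k (?y k)) = (\<Sum>k\<in>{1..N} - {1, j}. \<phi> k (x k))"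
    by (rule sum.cong) auto
  ultimately have "c (?y(1 := x 1, j := x j)) - (\<Sum>k\<in>{1..N} - {1, j}. \<phi> k (?y k)) = \<phi> 1 (x 1) + \<phi> j (x j)"
    using eq unfolding sep_def sum_split_1j by simp
  moreover have "?y \<in> (\<Pi>\<^sub>E k\<in>{1..N} - {1, j}. mspace (X k))" using x by (auto simp: PiE_iff)
  ultimately have "\<phi> 1 (x 1) + \<phi> j (x j) \<in> ?S" by (intro CollectI exI[of _ ?y] conjI) simp_all
  moreover have "bdd_below ?S"
    by (rule bdd_belowI[of _ "\<phi> 1 (x 1) + \<phi> j (x j)"]) (use cost_1j_elements_ge[OF x1j] in blast)
  ultimately show ?thesis unfolding cost_1j_def by (rule cInf_lower)
qed

abbreviation marginal_1j :: "(nat \<Rightarrow> 'a) measure \<Rightarrow> ('a \<times> 'a) measure" where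
  "marginal_1j P \<equiv> distr P (\<mu> 1 \<Otimes>\<^sub>M \<mu> j) (\<lambda>x. (x 1, x j))"

lemma proj_1j: "P \<in> plans N \<mu> \<Longrightarrow> (\<lambda>x. (x 1, x j)) \<in> measurable P (\<mu> 1 \<Otimes>\<^sub>M \<mu> j)"
  using plan_proj one jN by (intro measurable_Pair)

lemma marginal_1j_plan:
  assumes P: "P \<in> plans N \<mu>"
  shows "marginal_1j P \<in> plans2 (\<mu> 1) (\<mu> j)"
  unfolding plans2_def
proof (intro CollectI conjI)
  have "distr (marginal_1j P) (\<mu> 1) fst = distr P (\<mu> 1) (fst \<circ> (\<lambda>x. (x 1, x j)))"
    by (rule distr_distr[OF measurable_fst proj_1j[OF P]])
  then show "distr (marginal_1j P) (\<mu> 1) fst = \<mu> 1" using plan_marginal[OF P one] by (simp add: comp_def)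
  have "distr (marginal_1j P) (\<mu> j) snd = distr P (\<mu> j) (snd \<circ> (\<lambda>x. (x 1, x j)))"
    by (rule distr_distr[OF measurable_snd proj_1j[OF P]])
  then show "distr (marginal_1j P) (\<mu> j) snd = \<mu> j" using plan_marginal[OF P jN] by (simp add: comp_def)
qed simp

text \<open>The same number for every two-marginal plan: it is the benchmark against which reduced
  costs are compared. Completions appear because \<open>opt2\<close> integrates against
  them.\<close>

lemma plans2_integral:
  assumes \<tau>: "\<tau> \<in> plans2 (\<mu> 1) (\<mu> j)"
  defines "g \<equiv> \<lambda>z. \<phi> 1 (fst z) + \<phi> j (snd z)"
  shows "g \<in> borel_measurable \<tau>" "integrable (completion \<tau>) g"
    "(\<integral>z. g z \<partial>completion \<tau>) = (\<integral>y. \<phi> 1 y \<partial>\<mu> 1) + (\<integral>y. \<phi> j y \<partial>\<mu> j)"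
proof -
  have s: "sets \<tau> = sets (\<mu> 1 \<Otimes>\<^sub>M \<mu> j)" and d: "distr \<tau> (\<mu> 1) fst = \<mu> 1" "distr \<tau> (\<mu> j) snd = \<mu> j"
    using \<tau> by (auto simp: plans2_def)
  have m: "fst \<in> measurable \<tau> (\<mu> 1)" "snd \<in> measurable \<tau> (\<mu> j)"
    using measurable_cong_sets[OF s refl] by auto
  have i: "integrable (\<mu> 1) (\<phi> 1)" "integrable (\<mu> j) (\<phi> j)"
    using \<phi>_family one jN unfolding integrable_family_def by blast+
  have i1: "integrable \<tau> (\<lambda>z. \<phi> 1 (fst z))" "integrable \<tau> (\<lambda>z. \<phi> j (snd z))"
    using integrable_distr[OF m(1), of "\<phi> 1"] integrable_distr[OF m(2), of "\<phi> j"] i d by auto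
  have v: "(\<integral>z. \<phi> 1 (fst z) \<partial>\<tau>) = (\<integral>y. \<phi> 1 y \<partial>\<mu> 1)" "(\<integral>z. \<phi> j (snd z) \<partial>\<tau>) = (\<integral>y. \<phi> j y \<partial>\<mu> j)"
    using integral_distr[OF m(1), of "\<phi> 1"] integral_distr[OF m(2), of "\<phi> j"] i d by auto
  have ig: "integrable \<tau> g" unfolding g_def using i1 by simp
  then show gm: "g \<in> borel_measurable \<tau>" by simp
  show "integrable (completion \<tau>) g" using ig gm by (simp add: integrable_completion)
  show "(\<integral>z. g z \<partial>completion \<tau>) = (\<integral>y. \<phi> 1 y \<partial>\<mu> 1) + (\<integral>y. \<phi> j y \<partial>\<mu> j)"
    unfolding integral_completion[OF gm] using i1 v by (simp add: g_def)
qed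

text \<open>The reduced cost need not be Borel.  Compact inner approximation of the contact set makes the
  projection of an almost full part of it Borel, so that its complement is negligible.\<close>

lemma AE_marginal_cost_1j:
  assumes opt: "opt_MK N \<mu> c P"
  shows "AE z in marginal_1j P. cost_1j N X c \<phi> j (fst z) (snd z) = \<phi> 1 (fst z) + \<phi> j (snd z)"
proof -
  have P: "P \<in> plans N \<mu>" using opt by (simp add: opt_MK_def)
  interpret P: prob_space P by (rule plan_prob[OF P])
  have spP: "space P = \<Omega>" by (rule plan_space[OF P])
  have sP: "sets P = sets (borel_of prodtop)" using plan_sets[OF P] sets_PiM_\<mu> by simp
  obtain Z where Z: "{x \<in> space P. c x \<noteq> sep \<phi> x} \<subseteq> Z" "Z \<in> null_sets P"
    using complementary_slackness[OF opt] by (auto elim!: AE_E)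
  \<comment> \<open>A measurable set of full measure on which contact holds, as the inner
    approximation by compact sets requires.\<close>
  define A where "A = space P - Z"
  have A: "A \<in> sets P" using Z(2) unfolding A_def by auto
  have "\<exists>K. compactin prodtop K \<and> K \<subseteq> A \<and> measure P (A - K) \<le> 1 / real (Suc n)" for n
    by (rule borel_compact_approximation[OF completely_metrizable_prodtop second_countable_prodtop
          P.finite_measure_axioms sP A]) simp
  then obtain K where K: "\<And>n. compactin prodtop (K n)" "\<And>n. K n \<subseteq> A" "\<And>n. measure P (A - K n) \<le> 1 / real (Suc n)"
    by metis
  have haus: "Hausdorff_space (product_topology (\<lambda>k. mtopology_of (X k)) J)" if "J \<subseteq> {1..N}" for J
    unfolding Hausdorff_space_product_topology
    using completely_metrizable_X that completely_metrizable_imp_metrizable_space metrizable_imp_Hausdorff_space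
    by blast
  have Km: "K n \<in> sets P" for n
    using compactin_imp_closedin[OF haus[OF subset_refl] K(1)] borel_of_closed sP by blast
  have "measure P (A - (\<Union>n. K n)) \<le> 1 / real (Suc n)" for n
    using P.finite_measure_mono[of "A - (\<Union>n. K n)" "A - K n"] A Km K(3)[of n] by force
  then have "measure P (A - (\<Union>n. K n)) \<le> 0"
    by (meson dual_order.strict_trans1 linorder_not_le nat_approx_posE)
  then have "A - (\<Union>n. K n) \<in> null_sets P"
    using A Km by (auto simp: null_sets_def P.emeasure_eq_measure intro!: antisym)
  then have "AE x in P. x \<notin> Z \<union> (A - (\<Union>n. K n))" by (intro AE_not_in null_sets.Un Z(2))
  then have AEK: "AE x in P. x \<in> (\<Union>n. K n)"
    using AE_space by eventually_elim (auto simp: A_def)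
  let ?J = "{1, j}"
  let ?TJ = "product_topology (\<lambda>k. mtopology_of (X k)) ?J"
  have J: "?J \<subseteq> {1..N}" using one jN by blast
  define r where "r x = restrict x ?J" for x :: "nat \<Rightarrow> 'a"
  have r: "continuous_map prodtop ?TJ r"
    unfolding continuous_map_componentwise r_def
  proof (intro conjI ballI)
    show "(\<lambda>x. restrict x {1, j}) ` topspace prodtop \<subseteq> extensional {1, j}" by auto
    show "continuous_map prodtop (mtopology_of (X k)) (\<lambda>x. restrict x {1, j} k)" if "k \<in> {1, j}" for k
      using continuous_map_product_projection[of k "{1..N}" "\<lambda>k. mtopology_of (X k)"] that J by auto
  qed
  have sJ: "sets (PiM ?J \<mu>) = sets (borel_of ?TJ)"
  proof (rule sets_PiM_eq_borel_of_product)
    fix i assume "i \<in> ?J"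
    then have "i \<in> {1..N}" using J by blast
    then show "second_countable (mtopology_of (X i))" "sets (\<mu> i) = sets (borel_of (mtopology_of (X i)))"
      using second_countable_X borel by blast+
  qed simp
  have rK: "r ` K n \<in> sets (PiM ?J \<mu>)" for n
    unfolding sJ by (intro borel_of_closed compactin_imp_closedin haus J image_compactin[OF K(1) r])
  \<comment> \<open>The compact images live in functions on {1, j}. \<open>u\<close> identifies a
    pair with such a function and carries their measurability over to the binary product.\<close>
  define u where "u z = (\<lambda>i\<in>?J. if i = 1 then fst z else snd z)" for z :: "'a \<times> 'a"
  have um: "u \<in> measurable (\<mu> 1 \<Otimes>\<^sub>M \<mu> j) (PiM ?J \<mu>)"
    unfolding u_def[abs_def]
  proof (rule measurable_restrict)
    show "(\<lambda>z. if i = 1 then fst z else snd z) \<in> measurable (\<mu> 1 \<Otimes>\<^sub>M \<mu> j) (\<mu> i)" if "i \<in> ?J" for i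
      using that by (cases "i = 1") auto
  qed
  have ur: "u (x 1, x j) = r x" for x unfolding u_def r_def by (auto simp: fun_eq_iff)
  \<comment> \<open>A measurable set of pairs, of full measure for the marginal, each of whose
    points is the projection of a contact point.\<close>
  define B where "B = (\<Union>n. u -` (r ` K n) \<inter> space (\<mu> 1 \<Otimes>\<^sub>M \<mu> j))"
  have Bm: "B \<in> sets (\<mu> 1 \<Otimes>\<^sub>M \<mu> j)"
    unfolding B_def by (intro sets.countable_UN image_subsetI measurable_sets[OF um] rK)
  have "AE x in P. (x 1, x j) \<in> B"
    using AEK AE_space
  proof eventually_elim
    case (elim x)
    then obtain n where n: "x \<in> K n" by blast
    have "(x 1, x j) \<in> space (\<mu> 1 \<Otimes>\<^sub>M \<mu> j)" by (rule measurable_space[OF proj_1j[OF P] elim(2)])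
    then show ?case using n ur[of x] unfolding B_def by blast
  qed
  moreover have "{z \<in> space (\<mu> 1 \<Otimes>\<^sub>M \<mu> j). z \<in> B} \<in> sets (\<mu> 1 \<Otimes>\<^sub>M \<mu> j)"
    using Bm sets.sets_into_space[OF Bm] by (simp add: Collect_conj_eq Int_absorb1)
  ultimately have "AE z in marginal_1j P. z \<in> B" using AE_distr_iff[OF proj_1j[OF P], of "\<lambda>z. z \<in> B"] by simp
  then show ?thesis
  proof eventually_elim
    case (elim z)
    then obtain n x where x: "x \<in> K n" "u z = r x" unfolding B_def by blast
    have "u z 1 = fst z" "u z j = snd z" "r x 1 = x 1" "r x j = x j" using j1 by (auto simp: u_def r_def)
    then have z: "fst z = x 1" "snd z = x j" using x(2) by auto
    have "x \<in> A" using x(1) K(2) by blast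
    then have xO: "x \<in> \<Omega>" and eq: "c x = sep \<phi> x" using Z(1) spP by (auto simp: A_def)
    show ?case unfolding z
      using cost_1j_le[OF xO eq] cost_1j_ge PiE_mem[OF xO one] PiE_mem[OF xO jN] by (intro antisym)
  qed
qed

text \<open>For any competitor the reduced cost integrates to at least the universal value of \<phi>
  1 + \<phi> j; for the marginal of an optimal plan it attains this value.\<close>

lemma marginal_1j_optimal:
  assumes opt: "opt_MK N \<mu> c P"
  shows "opt2 (\<mu> 1) (\<mu> j) (case_prod (cost_1j N X c \<phi> j)) (marginal_1j P)"
proof -
  have P: "P \<in> plans N \<mu>" using opt by (simp add: opt_MK_def)
  let ?f = "case_prod (cost_1j N X c \<phi> j)"
  let ?g = "\<lambda>z. \<phi> 1 (fst z) + \<phi> j (snd z)"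
  note pl = marginal_1j_plan[OF P]
  note g = plans2_integral[OF pl]
  have ae: "AE z in marginal_1j P. ?f z = ?g z"
    using AE_marginal_cost_1j[OF opt] by (simp add: split_beta)
  have fm: "?f \<in> borel_measurable (completion (marginal_1j P))"
    by (rule borel_measurable_completion_AE[OF g(1) ae])
  have gm: "?g \<in> borel_measurable (completion (marginal_1j P))"
    by (rule measurable_completion[OF g(1)])
  have int: "integrable (completion (marginal_1j P)) ?f"
    using integrable_cong_AE[OF fm gm AE_completion[OF ae]] g(2) by blast
  have "(\<integral>z. ?f z \<partial>completion (marginal_1j P)) = (\<integral>z. ?g z \<partial>completion (marginal_1j P))"
    by (rule integral_cong_AE[OF fm gm AE_completion[OF ae]])
  also have "\<dots> = (\<integral>y. \<phi> 1 y \<partial>\<mu> 1) + (\<integral>y. \<phi> j y \<partial>\<mu> j)" by (rule g(3))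
  finally have v: "(\<integral>z. ?f z \<partial>completion (marginal_1j P)) = (\<integral>y. \<phi> 1 y \<partial>\<mu> 1) + (\<integral>y. \<phi> j y \<partial>\<mu> j)" .
  show ?thesis
    unfolding opt2_def
  proof (intro conjI ballI impI pl int)
    fix \<tau> assume \<tau>: "\<tau> \<in> plans2 (\<mu> 1) (\<mu> j)" and fi: "integrable (completion \<tau>) ?f"
    have sp: "space \<tau> = mspace (X 1) \<times> mspace (X j)"
      using \<tau> sets_eq_imp_space_eq[of \<tau> "\<mu> 1 \<Otimes>\<^sub>M \<mu> j"] space_\<mu>[OF one] space_\<mu>[OF jN]
      by (simp add: plans2_def space_pair_measure)
    have "(\<integral>z. ?g z \<partial>completion \<tau>) \<le> (\<integral>z. ?f z \<partial>completion \<tau>)"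
    proof (rule integral_mono[OF plans2_integral(2)[OF \<tau>] fi])
      fix z assume "z \<in> space (completion \<tau>)"
      then have "fst z \<in> mspace (X 1)" "snd z \<in> mspace (X j)" unfolding space_completion sp by auto
      then show "?g z \<le> ?f z" using cost_1j_ge by (simp add: split_beta)
    qed
    then show "(\<integral>z. ?f z \<partial>completion (marginal_1j P)) \<le> (\<integral>z. ?f z \<partial>completion \<tau>)"
      unfolding v plans2_integral(3)[OF \<tau>] .
  qed
qed

text \<open>A countable base of a Hausdorff space separates points, so equality of
  \<open>snd z\<close> and \<open>T (fst z)\<close> is a countable conjunction of measurable
  conditions.\<close>

lemma graph_measurable:
  assumes T: "T \<in> measurable (\<mu> 1) (\<mu> j)"
  shows "{z \<in> space (\<mu> 1 \<Otimes>\<^sub>M \<mu> j). snd z = T (fst z)} \<in> sets (\<mu> 1 \<Otimes>\<^sub>M \<mu> j)"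
proof -
  let ?M = "\<mu> 1 \<Otimes>\<^sub>M \<mu> j"
  obtain \<B> where B: "countable \<B>" "\<forall>V\<in>\<B>. openin (mtopology_of (X j)) V"
    "\<forall>U x. openin (mtopology_of (X j)) U \<and> x \<in> U \<longrightarrow> (\<exists>V\<in>\<B>. x \<in> V \<and> V \<subseteq> U)"
    using second_countable_X[OF jN] unfolding second_countable_def by blast
  have haus: "Hausdorff_space (mtopology_of (X j))"
    using completely_metrizable_X[OF jN] completely_metrizable_imp_metrizable_space metrizable_imp_Hausdorff_space
    by blast
  have sep: "y = y'" if y: "y \<in> mspace (X j)" "y' \<in> mspace (X j)" and V: "\<forall>V\<in>\<B>. y \<in> V \<longleftrightarrow> y' \<in> V" for y y'
  proof (rule ccontr)
    assume "y \<noteq> y'"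
    then obtain U U' where U: "openin (mtopology_of (X j)) U" "y \<in> U" "y' \<in> U'" "disjnt U U'"
      using haus y unfolding Hausdorff_space_def by (metis topspace_mtopology_of)
    then obtain V where "V \<in> \<B>" "y \<in> V" "V \<subseteq> U" using B(3) by blast
    with V U show False by (auto simp: disjnt_iff)
  qed
  have Vm: "V \<in> sets (\<mu> j)" if "V \<in> \<B>" for V
    using B(2) that borel_of_open borel[OF jN] by blast
  have T': "(\<lambda>z. T (fst z)) \<in> measurable ?M (\<mu> j)" using T by measurable
  have "{z \<in> space ?M. snd z \<in> V \<longleftrightarrow> T (fst z) \<in> V} \<in> sets ?M" if "V \<in> \<B>" for V
  proof -
    have [measurable]: "V \<in> sets (\<mu> j)" by (rule Vm[OF that])
    note T'[measurable]
    show ?thesis by measurable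
  qed
  then have "{z \<in> space ?M. \<forall>V\<in>\<B>. snd z \<in> V \<longleftrightarrow> T (fst z) \<in> V} \<in> sets ?M"
    by (rule sets.sets_Collect_countable_All'[OF _ B(1)])
  moreover have "(\<forall>V\<in>\<B>. snd z \<in> V \<longleftrightarrow> T (fst z) \<in> V) \<longleftrightarrow> snd z = T (fst z)" if z: "z \<in> space ?M" for z
  proof
    assume V: "\<forall>V\<in>\<B>. snd z \<in> V \<longleftrightarrow> T (fst z) \<in> V"
    have "snd z \<in> space (\<mu> j)" by (rule measurable_space[OF measurable_snd z])
    moreover have "T (fst z) \<in> space (\<mu> j)" by (rule measurable_space[OF T' z])
    ultimately show "snd z = T (fst z)" unfolding space_\<mu>[OF jN] by (rule sep[OF _ _ V])
  qed simp
  ultimately show ?thesis by (simp cong: conj_cong)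
qed

text \<open>Measurability of the graph lets the relation pass through image measures, from
  \<open>\<mu> 1\<close> to the marginal and from there to \<open>P\<close>.\<close>

lemma AE_graph:
  assumes P: "P \<in> plans N \<mu>" and T: "T \<in> measurable (\<mu> 1) (\<mu> j)"
    and eq: "marginal_1j P = distr (\<mu> 1) (\<mu> 1 \<Otimes>\<^sub>M \<mu> j) (\<lambda>x. (x, T x))"
  shows "AE x in P. x j = T (x 1)"
proof -
  have m: "(\<lambda>x. (x, T x)) \<in> measurable (\<mu> 1) (\<mu> 1 \<Otimes>\<^sub>M \<mu> j)" using T by measurable
  have "AE z in distr (\<mu> 1) (\<mu> 1 \<Otimes>\<^sub>M \<mu> j) (\<lambda>x. (x, T x)). snd z = T (fst z)"
    using AE_distr_iff[OF m graph_measurable[OF T]] by simp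
  then have "AE z in marginal_1j P. snd z = T (fst z)" unfolding eq .
  then show ?thesis using AE_distr_iff[OF proj_1j[OF P] graph_measurable[OF T]] by simp
qed

end

end

section \<open>Plans carried by graphs\<close>

text \<open>Disintegration is given on rectangles only. Placing \<kappa> x on the fibre over x
  defines a kernel \<open>k\<close>, and \<open>Q\<close> agrees with \<open>M \<bind> k\<close> on
  the intersection-stable rectangles, hence everywhere.\<close>

lemma emeasure_disintegration:
  assumes ne: "space M \<noteq> {}" and fin: "finite_measure Q" and sQ: "sets Q = sets (M \<Otimes>\<^sub>M L)"
    and \<kappa>: "\<kappa> \<in> measurable M (subprob_algebra L)"
    and rect: "\<And>E F. E \<in> sets M \<Longrightarrow> F \<in> sets L \<Longrightarrow> emeasure Q (E \<times> F) = (\<integral>\<^sup>+ x\<in>E. emeasure (\<kappa> x) F \<partial>M)"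
    and A: "A \<in> sets (M \<Otimes>\<^sub>M L)"
  shows "emeasure Q A = (\<integral>\<^sup>+ x. emeasure (\<kappa> x) (Pair x -` A) \<partial>M)"
proof -
  interpret Q: finite_measure Q by fact
  define k where "k x = distr (\<kappa> x) (M \<Otimes>\<^sub>M L) (Pair x)" for x
  have k: "k \<in> measurable M (subprob_algebra (M \<Otimes>\<^sub>M L))"
    unfolding k_def[abs_def] by (rule measurable_distr2[OF _ \<kappa>]) simp
  have s\<kappa>: "sets (\<kappa> x) = sets L" if "x \<in> space M" for x
    using measurable_space[OF \<kappa> that] by (simp add: space_subprob_algebra)
  have Pm: "Pair x \<in> measurable (\<kappa> x) (M \<Otimes>\<^sub>M L)" if "x \<in> space M" for x
    unfolding measurable_cong_sets[OF s\<kappa>[OF that] refl] by (rule measurable_Pair1'[OF that])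
  have ek: "emeasure (k x) B = emeasure (\<kappa> x) (Pair x -` B)" if x: "x \<in> space M" and B: "B \<in> sets (M \<Otimes>\<^sub>M L)" for x B
  proof -
    have "Pair x -` B \<inter> space (\<kappa> x) = Pair x -` B"
      using sets.sets_into_space[OF B] sets_eq_imp_space_eq[OF s\<kappa>[OF x]] by (auto simp: space_pair_measure)
    then show ?thesis unfolding k_def using emeasure_distr[OF Pm[OF x] B] by simp
  qed
  have bind: "emeasure (M \<bind> k) B = (\<integral>\<^sup>+ x. emeasure (\<kappa> x) (Pair x -` B) \<partial>M)" if "B \<in> sets (M \<Otimes>\<^sub>M L)" for B
    unfolding emeasure_bind[OF ne k that] by (rule nn_integral_cong) (rule ek[OF _ that])
  have sets_bind: "sets (M \<bind> k) = sets (M \<Otimes>\<^sub>M L)" by (rule sets_bind[OF sets_kernel[OF k] ne])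
  let ?E = "{a \<times> b |a b. a \<in> sets M \<and> b \<in> sets L}"
  have "Q = M \<bind> k"
  proof (rule measure_eqI_generator_eq[where E="?E" and \<Omega>="space M \<times> space L" and A="\<lambda>_::nat. space M \<times> space L"])
    show "Int_stable ?E" by (rule Int_stable_pair_measure_generator)
    show "?E \<subseteq> Pow (space M \<times> space L)" by (auto dest: sets.sets_into_space)
    show "sets Q = sigma_sets (space M \<times> space L) ?E" unfolding sQ by (rule sets_pair_measure)
    show "sets (M \<bind> k) = sigma_sets (space M \<times> space L) ?E" unfolding sets_bind by (rule sets_pair_measure)
    show "range (\<lambda>_::nat. space M \<times> space L) \<subseteq> ?E" by auto
    fix B assume "B \<in> ?E"
    then obtain E F where EF: "B = E \<times> F" "E \<in> sets M" "F \<in> sets L" by blast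
    have "emeasure (M \<bind> k) B = (\<integral>\<^sup>+ x. emeasure (\<kappa> x) (Pair x -` B) \<partial>M)" by (rule bind) (use EF in auto)
    also have "\<dots> = (\<integral>\<^sup>+ x\<in>E. emeasure (\<kappa> x) F \<partial>M)"
      by (rule nn_integral_cong) (auto simp: EF(1) indicator_def)
    finally show "emeasure Q B = emeasure (M \<bind> k) B" using rect[OF EF(2,3)] EF(1) by simp
  qed (auto simp: Q.emeasure_finite)
  then show ?thesis using bind[OF A] by simp
qed

text \<open>With Dirac factors in all but one coordinate, a product is the image of the remaining
  factor under the map that freezes the other coordinates. Comparison on boxes suffices, since they
  determine a finite product measure.\<close>

lemma PiM_return_but_one:
  fixes \<nu> :: "'i \<Rightarrow> 'x measure" and \<kappa> :: "'x measure"
  assumes I: "finite I" and i: "i \<in> I" and \<kappa>: "prob_space \<kappa>" "sets \<kappa> = sets (\<nu> i)"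
    and t: "\<And>j. j \<in> I - {i} \<Longrightarrow> t j \<in> space (\<nu> j)"
  shows "PiM I (\<lambda>j. if j = i then \<kappa> else return (\<nu> j) (t j)) =
    distr \<kappa> (PiM I \<nu>) (\<lambda>y. \<lambda>j\<in>I. if j = i then y else t j)"
proof -
  interpret \<kappa>: prob_space \<kappa> by fact
  \<comment> \<open>\<open>product_sigma_finite\<close> demands a measure at every index; outside
    \<open>I\<close> the value \<kappa> is a placeholder.\<close>
  define M where "M j = (if j \<in> I then if j = i then \<kappa> else return (\<nu> j) (t j) else \<kappa>)" for j
  define h where "h y = (\<lambda>j\<in>I. if j = i then y else t j)" for y
  have "prob_space (M j)" for j
    unfolding M_def using \<kappa>(1) t by (auto intro: prob_space_return)
  then interpret product_sigma_finite M
    by unfold_locales (meson prob_space_imp_sigma_finite sigma_finite_measure.sigma_finite_countable)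
  have sM: "sets (M j) = sets (\<nu> j)" if "j \<in> I" for j using that \<kappa>(2) by (simp add: M_def)
  have h: "h \<in> measurable \<kappa> (PiM I \<nu>)"
    unfolding h_def[abs_def]
  proof (rule measurable_restrict)
    show "(\<lambda>y. if j = i then y else t j) \<in> measurable \<kappa> (\<nu> j)" if "j \<in> I" for j
      using t[of j] that measurable_ident_sets[OF \<kappa>(2)] by (cases "j = i") auto
  qed
  have "distr \<kappa> (PiM I \<nu>) h = PiM I M"
  proof (rule PiM_eqI[OF I])
    show "sets (distr \<kappa> (PiM I \<nu>) h) = sets (PiM I M)" using sets_PiM_cong[OF refl sM, of I] by simp
    fix A assume "\<And>j. j \<in> I \<Longrightarrow> A j \<in> sets (M j)"
    then have A: "A j \<in> sets (\<nu> j)" if "j \<in> I" for j using that sM by blast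
    have "emeasure (distr \<kappa> (PiM I \<nu>) h) (PiE I A) = emeasure \<kappa> (h -` PiE I A \<inter> space \<kappa>)"
      by (rule emeasure_distr[OF h sets_PiM_I_finite[OF I A]])
    also have "h -` PiE I A \<inter> space \<kappa> = (if \<forall>j\<in>I - {i}. t j \<in> A j then A i else {})"
    proof -
      have "h y \<in> PiE I A \<longleftrightarrow> (\<forall>j\<in>I - {i}. t j \<in> A j) \<and> y \<in> A i" for y
        using i by (auto simp: h_def PiE_iff)
      moreover have "A i \<subseteq> space \<kappa>"
        using sets.sets_into_space[OF A[OF i]] sets_eq_imp_space_eq[OF \<kappa>(2)] by simp
      ultimately show ?thesis by auto
    qed
    also have "emeasure \<kappa> \<dots> = emeasure \<kappa> (A i) * (\<Prod>j\<in>I - {i}. indicator (A j) (t j))"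
      using I by (auto simp: indicator_def prod_zero_iff)
    also have "\<dots> = emeasure (M i) (A i) * (\<Prod>j\<in>I - {i}. emeasure (M j) (A j))"
      using i A by (auto simp: M_def intro!: arg_cong2[where f="(*)"] prod.cong)
    also have "\<dots> = (\<Prod>j\<in>I. emeasure (M j) (A j))" by (rule prod.remove[OF I i, symmetric])
    finally show "emeasure (distr \<kappa> (PiM I \<nu>) h) (PiE I A) = (\<Prod>j\<in>I. emeasure (M j) (A j))" .
  qed
  also have "PiM I M = PiM I (\<lambda>j. if j = i then \<kappa> else return (\<nu> j) (t j))"
    by (rule PiM_cong) (simp_all add: M_def)
  finally show ?thesis by (simp add: h_def[abs_def])
qed

section \<open>Recovering an optimal plan from two coordinates\<close>

context dual_optimum
begin

context
  fixes j0 :: nat and T :: "nat \<Rightarrow> 'a \<Rightarrow> 'a"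
  assumes j0: "j0 \<in> {2..N}"
    and maps: "\<And>j. j \<in> {2..N} - {j0} \<Longrightarrow> T j \<in> measurable (\<mu> 1) (\<mu> j) \<and>
        (\<forall>\<tau>. opt2 (\<mu> 1) (\<mu> j) (case_prod (cost_1j N X c \<phi> j)) \<tau> \<longleftrightarrow>
              \<tau> = distr (\<mu> 1) (\<mu> 1 \<Otimes>\<^sub>M \<mu> j) (\<lambda>x. (x, T j x)))"
begin

lemma AE_transport_maps:
  assumes opt: "opt_MK N \<mu> c P"
  shows "AE x in P. \<forall>j\<in>{2..N} - {j0}. x j = T j (x 1)"
proof (rule AE_finite_allI)
  fix j assume j: "j \<in> {2..N} - {j0}"
  then have j': "j \<in> {2..N}" by simp
  have P: "P \<in> plans N \<mu>" using opt by (simp add: opt_MK_def)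
  show "AE x in P. x j = T j (x 1)"
    using AE_graph[OF j' P] maps[OF j] marginal_1j_optimal[OF j' opt] by blast
qed simp

text \<open>Rebuilds a point from its coordinates 1 and \<open>j0\<close> by means of the transport
  maps. The index set is a parameter because whole plans use {1..N} and the disintegration over the
  first marginal uses {2..N}.\<close>

definition assemble :: "nat set \<Rightarrow> 'a \<times> 'a \<Rightarrow> nat \<Rightarrow> 'a" where
  "assemble J z = (\<lambda>j\<in>J. if j = 1 then fst z else if j = j0 then snd z else T j (fst z))"

lemma assemble_measurable:
  assumes "J \<subseteq> {1..N}"
  shows "assemble J \<in> measurable (\<mu> 1 \<Otimes>\<^sub>M \<mu> j0) (PiM J \<mu>)"
  unfolding assemble_def[abs_def]
proof (rule measurable_restrict)
  fix j assume j: "j \<in> J"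
  consider "j = 1" | "j = j0" "j \<noteq> 1" | "j \<in> {2..N} - {j0}" "j \<noteq> 1" using j assms by fastforce
  then show "(\<lambda>z. if j = 1 then fst z else if j = j0 then snd z else T j (fst z)) \<in> measurable (\<mu> 1 \<Otimes>\<^sub>M \<mu> j0) (\<mu> j)"
  proof cases
    case 3
    then have "T j \<in> measurable (\<mu> 1) (\<mu> j)" using maps by blast
    then show ?thesis using 3 by simp
  qed simp_all
qed

lemma AE_assemble:
  assumes opt: "opt_MK N \<mu> c P" and J: "J \<subseteq> {1..N}"
  shows "AE x in P. restrict x J = assemble J (x 1, x j0)"
  using AE_transport_maps[OF opt]
proof eventually_elim
  case (elim x)
  show ?case
  proof
    fix j
    consider "j \<notin> J" | "j = 1" | "j = j0" | "j \<in> {2..N} - {j0}" "j \<noteq> 1" using J by fastforce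
    then show "restrict x J j = assemble J (x 1, x j0) j"
      using elim by cases (auto simp: assemble_def restrict_def)
  qed
qed

text \<open>Almost every point is assembled from its coordinates 1 and \<open>j0\<close>, so the
  marginal on these two coordinates determines an optimal plan; this is the source of
  uniqueness.\<close>

lemma optimal_plan_eq_distr:
  assumes opt: "opt_MK N \<mu> c P"
  shows "P = distr (marginal_1j j0 P) (PiM {1..N} \<mu>) (assemble {1..N})"
proof -
  have P: "P \<in> plans N \<mu>" using opt by (simp add: opt_MK_def)
  note a = assemble_measurable[OF subset_refl]
  note p = proj_1j[OF j0 P]
  have "distr (marginal_1j j0 P) (PiM {1..N} \<mu>) (assemble {1..N}) =
      distr P (PiM {1..N} \<mu>) (assemble {1..N} \<circ> (\<lambda>x. (x 1, x j0)))"
    by (rule distr_distr[OF a p])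
  also have "\<dots> = distr P (PiM {1..N} \<mu>) (\<lambda>x. x)"
  proof (rule distr_cong_AE)
    show "AE x in P. (assemble {1..N} \<circ> (\<lambda>x. (x 1, x j0))) x = x"
      using AE_assemble[OF opt subset_refl] AE_space
    proof eventually_elim
      case (elim x)
      then have "restrict x {1..N} = x" using plan_space[OF P] by (auto intro: PiE_restrict)
      with elim show ?case by simp
    qed
    show "assemble {1..N} \<circ> (\<lambda>x. (x 1, x j0)) \<in> measurable P (PiM {1..N} \<mu>)"
      by (rule measurable_comp[OF p a])
  qed (use measurable_ident_sets[OF plan_sets[OF P]] in auto)
  also have "\<dots> = P" by (rule distr_id2) (rule plan_sets[OF P, symmetric])
  finally show ?thesis ..
qed

text \<open>Up to a null set the event depends on coordinates 1 and \<open>j0\<close> alone, so the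
  given disintegration applies. Its section over a point \<open>x\<close> of \<open>E\<close> is the
  preimage of \<open>F\<close> under the map freezing the coordinates T j x, and the image of
  \<kappa> x under that map is the required product.\<close>

lemma optimal_plan_formula:
  assumes opt: "opt_MK N \<mu> c P" and \<kappa>: "\<kappa> \<in> measurable (\<mu> 1) (prob_algebra (\<mu> j0))"
    and dis: "\<forall>E\<in>sets (\<mu> 1). \<forall>F\<in>sets (\<mu> j0).
       emeasure P {x \<in> space P. x 1 \<in> E \<and> x j0 \<in> F} = (\<integral>\<^sup>+ x1\<in>E. emeasure (\<kappa> x1) F \<partial>\<mu> 1)"
    and E: "E \<in> sets (\<mu> 1)" and F: "F \<in> sets (PiM {2..N} \<mu>)"
  shows "emeasure P {x \<in> space P. x 1 \<in> E \<and> restrict x {2..N} \<in> F} =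
    (\<integral>\<^sup>+ x1\<in>E. emeasure (PiM {2..N} (\<lambda>j. if j = j0 then \<kappa> x1 else return (\<mu> j) (T j x1))) F \<partial>\<mu> 1)"
proof -
  have P: "P \<in> plans N \<mu>" using opt by (simp add: opt_MK_def)
  interpret P: prob_space P by (rule plan_prob[OF P])
  have one: "1 \<in> {1..N}" using N2 by simp
  have J: "{2..N} \<subseteq> {1..N}" by auto
  note p = proj_1j[OF j0 P] and a = assemble_measurable[OF J]
  let ?M = "\<mu> 1 \<Otimes>\<^sub>M \<mu> j0"
  define A where "A = {z \<in> space ?M. fst z \<in> E \<and> assemble {2..N} z \<in> F}"
  have A: "A \<in> sets ?M"
  proof -
    have "A = (fst -` E \<inter> space ?M) \<inter> (assemble {2..N} -` F \<inter> space ?M)" unfolding A_def by auto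
    then show ?thesis using measurable_sets[OF measurable_fst E] measurable_sets[OF a F] by auto
  qed
  have rm: "(\<lambda>x. restrict x {2..N}) \<in> measurable P (PiM {2..N} \<mu>)"
    using measurable_restrict_subset[OF J, of \<mu>] measurable_cong_sets[OF plan_sets[OF P] refl] by blast
  have "emeasure P {x \<in> space P. x 1 \<in> E \<and> restrict x {2..N} \<in> F} = emeasure P ((\<lambda>x. (x 1, x j0)) -` A \<inter> space P)"
  proof (rule emeasure_eq_AE)
    show "AE x in P. x \<in> {x \<in> space P. x 1 \<in> E \<and> restrict x {2..N} \<in> F} \<longleftrightarrow>
        x \<in> (\<lambda>x. (x 1, x j0)) -` A \<inter> space P"
      using AE_assemble[OF opt J] AE_space
    proof eventually_elim
      case (elim x)
      have "(x 1, x j0) \<in> space ?M" by (rule measurable_space[OF p elim(2)])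
      then show ?case using elim unfolding A_def by simp
    qed
    have "{x \<in> space P. x 1 \<in> E \<and> restrict x {2..N} \<in> F} =
        ((\<lambda>x. x 1) -` E \<inter> space P) \<inter> ((\<lambda>x. restrict x {2..N}) -` F \<inter> space P)" by auto
    then show "{x \<in> space P. x 1 \<in> E \<and> restrict x {2..N} \<in> F} \<in> sets P"
      using measurable_sets[OF plan_proj[OF P one] E] measurable_sets[OF rm F] by auto
    show "(\<lambda>x. (x 1, x j0)) -` A \<inter> space P \<in> sets P" by (rule measurable_sets[OF p A])
  qed
  also have "\<dots> = emeasure (marginal_1j j0 P) A" by (rule emeasure_distr[OF p A, symmetric])
  also have "\<dots> = (\<integral>\<^sup>+ x. emeasure (\<kappa> x) (Pair x -` A) \<partial>\<mu> 1)"
  proof (rule emeasure_disintegration[OF _ _ _ measurable_prob_algebraD[OF \<kappa>] _ A])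
    show "space (\<mu> 1) \<noteq> {}" by (rule prob_space.not_empty[OF prob_\<mu>[OF one]])
    show "finite_measure (marginal_1j j0 P)" by (rule P.finite_measure_distr[OF p])
    fix E F assume E: "E \<in> sets (\<mu> 1)" and F: "F \<in> sets (\<mu> j0)"
    have "emeasure (marginal_1j j0 P) (E \<times> F) = emeasure P ((\<lambda>x. (x 1, x j0)) -` (E \<times> F) \<inter> space P)"
      by (rule emeasure_distr[OF p]) (use E F in auto)
    also have "(\<lambda>x. (x 1, x j0)) -` (E \<times> F) \<inter> space P = {x \<in> space P. x 1 \<in> E \<and> x j0 \<in> F}" by auto
    finally show "emeasure (marginal_1j j0 P) (E \<times> F) = (\<integral>\<^sup>+ x\<in>E. emeasure (\<kappa> x) F \<partial>\<mu> 1)"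
      using dis E F by simp
  qed simp
  also have "\<dots> = (\<integral>\<^sup>+ x1\<in>E. emeasure (PiM {2..N} (\<lambda>j. if j = j0 then \<kappa> x1 else return (\<mu> j) (T j x1))) F \<partial>\<mu> 1)"
  proof (rule nn_integral_cong)
    fix x assume x: "x \<in> space (\<mu> 1)"
    have \<kappa>x: "prob_space (\<kappa> x)" "sets (\<kappa> x) = sets (\<mu> j0)"
      using measurable_space[OF \<kappa> x] by (auto simp: space_prob_algebra)
    define h where "h y = (\<lambda>j\<in>{2..N}. if j = j0 then y else T j x)" for y
    have Tx: "T j x \<in> space (\<mu> j)" if "j \<in> {2..N} - {j0}" for j
      using maps[OF that] measurable_space[OF _ x] by blast
    have hm: "h y = assemble {2..N} (x, y)" for y unfolding h_def assemble_def by (auto simp: fun_eq_iff)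
    have hcomp: "h = assemble {2..N} \<circ> Pair x" unfolding comp_def by (rule ext) (rule hm)
    have "Pair x \<in> measurable (\<kappa> x) ?M"
      unfolding measurable_cong_sets[OF \<kappa>x(2) refl] by (rule measurable_Pair1'[OF x])
    then have hmeas: "h \<in> measurable (\<kappa> x) (PiM {2..N} \<mu>)" unfolding hcomp by (rule measurable_comp[OF _ a])
    have "emeasure (PiM {2..N} (\<lambda>j. if j = j0 then \<kappa> x else return (\<mu> j) (T j x))) F =
        emeasure (distr (\<kappa> x) (PiM {2..N} \<mu>) h) F"
      unfolding h_def[abs_def]
      by (rule arg_cong[OF PiM_return_but_one[where \<nu>=\<mu> and t="\<lambda>j. T j x"]]) (use j0 \<kappa>x Tx in auto)
    also have "\<dots> = emeasure (\<kappa> x) (h -` F \<inter> space (\<kappa> x))" by (rule emeasure_distr[OF hmeas F])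
    finally have e: "emeasure (PiM {2..N} (\<lambda>j. if j = j0 then \<kappa> x else return (\<mu> j) (T j x))) F =
        emeasure (\<kappa> x) (h -` F \<inter> space (\<kappa> x))" .
    \<comment> \<open>The section is empty for \<open>x\<close> outside \<open>E\<close>, which
      produces the indicator in the set integral.\<close>
    have "Pair x -` A = (if x \<in> E then h -` F \<inter> space (\<kappa> x) else {})"
      using x sets_eq_imp_space_eq[OF \<kappa>x(2)] by (auto simp: A_def hm space_pair_measure)
    then show "emeasure (\<kappa> x) (Pair x -` A) =
        emeasure (PiM {2..N} (\<lambda>j. if j = j0 then \<kappa> x else return (\<mu> j) (T j x))) F * indicator E x"
      unfolding e by simp
  qed
  finally show ?thesis .
qed

lemma optimal_plan_unique:
  assumes uniq: "\<exists>!\<tau>. opt2 (\<mu> 1) (\<mu> j0) (case_prod (cost_1j N X c \<phi> j0)) \<tau>"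
    and opt: "opt_MK N \<mu> c P" "opt_MK N \<mu> c P'"
  shows "P = P'"
proof -
  have "marginal_1j j0 P = marginal_1j j0 P'"
    using uniq marginal_1j_optimal[OF j0 opt(1)] marginal_1j_optimal[OF j0 opt(2)] by blast
  then show ?thesis using optimal_plan_eq_distr[OF opt(1)] optimal_plan_eq_distr[OF opt(2)] by simp
qed

end

end

text \<open>The identity of measures is tested on rectangles, which determine a finite measure;
  indexing the product by {2..N} encodes the order of its factors. The spaces share one type and are
  told apart by the carriers of \<open>X k\<close>.\<close>

theorem mainTheorem6:
  fixes N j0 :: nat
    and X :: "nat \<Rightarrow> 'a metric"
    and \<mu> :: "nat \<Rightarrow> 'a measure"
    and c :: "(nat \<Rightarrow> 'a) \<Rightarrow> real"
    and a \<phi> :: "nat \<Rightarrow> 'a \<Rightarrow> real"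
    and T :: "nat \<Rightarrow> 'a \<Rightarrow> 'a"
  assumes N3: "N \<ge> 3"
    and j0: "j0 \<in> {2..N}"
    and polish: "\<And>k. k \<in> {1..N} \<Longrightarrow> mcomplete_of (X k) \<and> separable_space (mtopology_of (X k))"
    and borel: "\<And>k. k \<in> {1..N} \<Longrightarrow> prob_space (\<mu> k) \<and> sets (\<mu> k) = sets (borel_of (mtopology_of (X k)))"
    and lsc: "lsc_top (product_topology (\<lambda>k. mtopology_of (X k)) {1..N}) c"
    and a_int: "\<And>k. k \<in> {1..N} \<Longrightarrow> integrable (\<mu> k) (a k)"
    and c_lb: "\<And>x. x \<in> PiE {1..N} (\<lambda>k. mspace (X k)) \<Longrightarrow> (\<Sum>k\<in>{1..N}. a k (x k)) \<le> c x"
    and attained: "\<exists>P. opt_MK N \<mu> c P"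
    and dual: "dual_sol N X \<mu> c \<phi>"
    and maps: "\<And>j. j \<in> {2..N} - {j0} \<Longrightarrow>
        T j \<in> measurable (\<mu> 1) (\<mu> j) \<and>
        (\<forall>\<tau>. opt2 (\<mu> 1) (\<mu> j) (case_prod (cost_1j N X c \<phi> j)) \<tau> \<longleftrightarrow>
              \<tau> = distr (\<mu> 1) (\<mu> 1 \<Otimes>\<^sub>M \<mu> j) (\<lambda>x. (x, T j x)))"
  shows "(\<forall>P \<kappa>. opt_MK N \<mu> c P \<and> \<kappa> \<in> measurable (\<mu> 1) (prob_algebra (\<mu> j0)) \<and>
            (\<forall>E\<in>sets (\<mu> 1). \<forall>F\<in>sets (\<mu> j0).
               emeasure P {x \<in> space P. x 1 \<in> E \<and> x j0 \<in> F}
                 = (\<integral>\<^sup>+ x1\<in>E. emeasure (\<kappa> x1) F \<partial>\<mu> 1)) \<longrightarrow>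
            (\<forall>E\<in>sets (\<mu> 1). \<forall>F\<in>sets (PiM {2..N} \<mu>).
               emeasure P {x \<in> space P. x 1 \<in> E \<and> restrict x {2..N} \<in> F}
                 = (\<integral>\<^sup>+ x1\<in>E. emeasure (PiM {2..N} (\<lambda>j. if j = j0 then \<kappa> x1
                                                    else return (\<mu> j) (T j x1))) F \<partial>\<mu> 1)))
       \<and> ((\<exists>!\<tau>. opt2 (\<mu> 1) (\<mu> j0) (case_prod (cost_1j N X c \<phi> j0)) \<tau>) \<longrightarrow>
            (\<exists>!P. opt_MK N \<mu> c P))"
proof -
  have N1: "N \<ge> 1" and N2: "N \<ge> 2" using N3 by simp_all
  interpret dual_optimum N X \<mu> c a \<phi>
    by (intro dual_optimum.intro multimarginal.intro dual_optimum_axioms.intro)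
      (fact N1 polish borel lsc a_int c_lb N2 dual)+
  show ?thesis
  proof (intro conjI allI impI ballI)
    fix P \<kappa> E F
    assume asm: "opt_MK N \<mu> c P \<and> \<kappa> \<in> measurable (\<mu> 1) (prob_algebra (\<mu> j0)) \<and>
            (\<forall>E\<in>sets (\<mu> 1). \<forall>F\<in>sets (\<mu> j0).
               emeasure P {x \<in> space P. x 1 \<in> E \<and> x j0 \<in> F}
                 = (\<integral>\<^sup>+ x1\<in>E. emeasure (\<kappa> x1) F \<partial>\<mu> 1))"
      and E: "E \<in> sets (\<mu> 1)" and F: "F \<in> sets (PiM {2..N} \<mu>)"
    show "emeasure P {x \<in> space P. x 1 \<in> E \<and> restrict x {2..N} \<in> F}
        = (\<integral>\<^sup>+ x1\<in>E. emeasure (PiM {2..N} (\<lambda>j. if j = j0 then \<kappa> x1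
                                                    else return (\<mu> j) (T j x1))) F \<partial>\<mu> 1)"
      using asm by (intro optimal_plan_formula[OF j0 maps _ _ _ E F]) blast+
  next
    assume uniq: "\<exists>!\<tau>. opt2 (\<mu> 1) (\<mu> j0) (case_prod (cost_1j N X c \<phi> j0)) \<tau>"
    \<comment> \<open>Existence is the assumed attainment, which leaves uniqueness.\<close>
    obtain P where P: "opt_MK N \<mu> c P" using attained ..
    show "\<exists>!P. opt_MK N \<mu> c P"
    proof (rule ex1I[of "opt_MK N \<mu> c", OF P])
      show "P' = P" if "opt_MK N \<mu> c P'" for P'
        by (rule optimal_plan_unique[OF j0 maps uniq that P])
    qed
  qed
qed

end
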